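(* Let $\Gamma\subset\tilde\Gamma\subset \mathrm{SL}(2,\mathbb C)$ be discrete subgroups, both containing $\pm I_2$, such that $\Gamma\backslash\mathbb H^3$ has finite hyperbolic volume and $[\tilde\Gamma:\Gamma]<\infty$. Let $\chi$ be a finite dimensional unitary representation of $\Gamma$ and let $\pi=\mathrm{Ind}_{\Gamma}^{\tilde\Gamma}\chi$. If the Eisenstein series of $(\Gamma,\chi)$ and of $(\tilde\Gamma,\pi)$ are normalized by compatible scaling matrices (as defined in the context), then the scattering functions satisfy $$\phi(s;\Gamma;\chi)=\phi(s;\tilde\Gamma;\pi)$$ for $s\in\mathbb C$, as an identity of meromorphic functions.
   Context: $\mathbb H^3=\mathbb R^2\times(0,\infty)$ is hyperbolic 3-space with the standard isometric action of $\mathrm{SL}(2,\mathbb C)$ (extended to the boundary $\mathbb C\cup\{\infty\}$); for $\omega=(x_1,x_2,y)$ write $y(\omega)=y$ and $y^s(\omega)=y(\omega)^s$. Eisenstein series. Let $G\subset\mathrm{SL}(2,\mathbb C)$ be a discrete subgroup containing $\pm I_2$ with $G\backslash\mathbb H^3$ of finite volume, and $\rho$ a finite dimensional unitary representation of $G$ on $V_\rho$. Let $\mathfrak a_1,\dots,\mathfrak a_h$ be a complete set of $G$-inequivalent cusps, and fix scaling matrices $\sigma_j\in\mathrm{SL}(2,\mathbb C)$ with $\sigma_j\infty=\mathfrak a_j$. Let $G_j$ be the (full) stabilizer of $\mathfrak a_j$ in $G$, and let $V_j=\{v\in V_\rho:\rho(g)v=v\ \forall g\in G_j\}$ be the singular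 space at $\mathfrak a_j$. Choose an orthonormal basis $\{v_{j,l}\}_l$ of each $V_j$. For $\mathrm{Re}(s)>2$ the Eisenstein series are the absolutely convergent series $$E_{j,l}(\omega,s;\rho)=\sum_{g\in G_j\backslash G}y^s(\sigma_j^{-1}g\,\omega)\,\rho(g^{-1})v_{j,l},$$ and it is known that they have meromorphic continuation to $s\in\mathbb C$. Scattering function. Let $\mathcal E(\omega,s;\rho)$ be the column vector of all $E_{j,l}(\omega,s;\rho)$. The scattering matrix $\mathfrak S(s;G;\rho)$ is the matrix of meromorphic functions of $s$ determined by the functional equation $$\mathcal E(\omega,s;\rho)=\mathfrak S(s;G;\rho)\,\mathcal E(\omega,2-s;\rho),$$ and the scattering function is $\phi(s;G;\rho)=\det\mathfrak S(s;G;\rho)$ (independent of the choice of bases of the $V_j$; equal to $1$ if there are no Eisenstein series). Compatible scaling matrices. Let $\tilde{\mathfrak a}_1,\dots,\tilde{\mathfrak a}_{\tilde h}$ be a complete set of $\tilde\Gamma$-inequivalent cusps of $\tilde\Gamma$ with scaling matrices $\tilde\sigma_1,\dots,\tilde\sigma_{\tilde h}$, and $\mathfrak a_1,\dots,\mathfrak a_h$ a complete set of $\Gamma$-inequivalent cusps of $\Gamma$. Each $\mathfrak a_j$ is $\tilde\Gamma$-equivalent to exactly one $\tilde{\mathfrak a}_k$, $k=k(j)$; the scaling matrices for $\Gamma$ are compatible with those of $\tilde\Gamma$ if they are chosen of the form $\sigma_j=\tau_j\tilde\sigma_{k(j)}$ with $\tau_j\in\tilde\Gamma$, $\tau_j\tilde{\mathfrak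 a}_{k(j)}=\mathfrak a_j$. (When $\tilde\Gamma$ has only one cusp class, represented by $\infty$ with $\tilde\sigma_1=I_2$, this means $\sigma_j\in\tilde\Gamma$ for all $j$.) *)

theory Defs
  imports
    "HOL-Complex_Analysis.Complex_Analysis"
    "HOL-Algebra.Coset"
    "HOL-Library.Function_Algebras"
    "Jordan_Normal_Form.Determinant"
begin

(* Two-by-two matrices are HOL-Analysis matrices; scattering matrices, whose size is not known
   statically, are Jordan_Normal_Form matrices. *)
no_notation Matrix.vec_index (infixl "$" 100)

type_synonym cmat2 = "complex ^ 2 ^ 2"

definition SL2C :: "cmat2 monoid" where
  "SL2C = \<lparr>carrier = {A. Determinants.det A = 1}, mult = (**), one = Finite_Cartesian_Product.mat 1\<rparr>"


section \<open>Hyperbolic 3-space, cusps and scaling matrices\<close>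

text \<open>The point \<open>(x1, x2, y)\<close> of the upper half-space is \<open>(Complex x1 x2, y)\<close>.\<close>

type_synonym hpoint = "complex \<times> real"

definition H3 :: "hpoint set" where
  "H3 = {(z, y). 0 < y}"

definition hyp_act :: "cmat2 \<Rightarrow> hpoint \<Rightarrow> hpoint" where
  "hyp_act A \<omega> = (case \<omega> of (z, y) \<Rightarrow>
     let a = A$1$1; b = A$1$2; c = A$2$1; d = A$2$2;
         N = (cmod (c * z + d))\<^sup>2 + (cmod c)\<^sup>2 * y\<^sup>2
     in (((a * z + b) * cnj (c * z + d) + a * cnj c * complex_of_real (y\<^sup>2)) / complex_of_real N,
         y / N))"

definition hyp_volume :: "hpoint measure" where
  "hyp_volume = density lborel (\<lambda>(z, y). if 0 < y then ennreal (1 / y ^ 3) else 0)"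

definition fundamental_domain :: "cmat2 set \<Rightarrow> hpoint set \<Rightarrow> bool" where
  "fundamental_domain G F \<longleftrightarrow>
     F \<in> sets borel \<and> F \<subseteq> H3 \<and> (\<Union>g\<in>G. hyp_act g ` F) = H3 \<and>
     (\<forall>g\<in>G. g \<noteq> Finite_Cartesian_Product.mat 1 \<longrightarrow> g \<noteq> - Finite_Cartesian_Product.mat 1 \<longrightarrow>
        emeasure hyp_volume (F \<inter> hyp_act g ` F) = 0)"

definition finite_covolume :: "cmat2 set \<Rightarrow> bool" where
  "finite_covolume G \<longleftrightarrow> (\<exists>F. fundamental_domain G F \<and> emeasure hyp_volume F < \<infinity>)"

text \<open>Boundary points are elements of \<open>complex option\<close>; \<open>None\<close> is the point at infinity.\<close>

definition moebius :: "cmat2 \<Rightarrow> complex option \<Rightarrow> complex option" where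
  "moebius A \<zeta> = (let a = A$1$1; b = A$1$2; c = A$2$1; d = A$2$2 in
     case \<zeta> of
       None \<Rightarrow> (if c = 0 then None else Some (a / c))
     | Some z \<Rightarrow> (if c * z + d = 0 then None else Some ((a * z + b) / (c * z + d))))"

definition parabolic :: "cmat2 \<Rightarrow> bool" where
  "parabolic A \<longleftrightarrow> A \<in> carrier SL2C \<and>
     A \<noteq> Finite_Cartesian_Product.mat 1 \<and> A \<noteq> - Finite_Cartesian_Product.mat 1 \<and>
     (trace A = 2 \<or> trace A = - 2)"

definition cusp :: "cmat2 set \<Rightarrow> complex option \<Rightarrow> bool" where
  "cusp G \<zeta> \<longleftrightarrow> (\<exists>g\<in>G. parabolic g \<and> moebius g \<zeta> = \<zeta>)"

definition cusp_stabilizer :: "cmat2 set \<Rightarrow> complex option \<Rightarrow> cmat2 set" where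
  "cusp_stabilizer G \<zeta> = {g \<in> G. moebius g \<zeta> = \<zeta>}"

definition complete_cusps :: "cmat2 set \<Rightarrow> complex option list \<Rightarrow> bool" where
  "complete_cusps G as \<longleftrightarrow> (\<forall>\<zeta>\<in>set as. cusp G \<zeta>) \<and>
     (\<forall>\<zeta>. cusp G \<zeta> \<longrightarrow> (\<exists>!j. j < length as \<and> (\<exists>g\<in>G. moebius g (as ! j) = \<zeta>)))"

definition scaling_matrices :: "complex option list \<Rightarrow> cmat2 list \<Rightarrow> bool" where
  "scaling_matrices as \<sigma>s \<longleftrightarrow> length \<sigma>s = length as \<and>
     (\<forall>j<length as. \<sigma>s ! j \<in> carrier SL2C \<and> moebius (\<sigma>s ! j) None = as ! j)"

definition compatible_scaling ::
  "cmat2 set \<Rightarrow> complex option list \<Rightarrow> cmat2 list \<Rightarrow> complex option list \<Rightarrow> cmat2 list \<Rightarrow> bool" where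
  "compatible_scaling G' as' \<sigma>s' as \<sigma>s \<longleftrightarrow>
     (\<forall>j<length as. \<exists>k<length as'. \<exists>\<tau>\<in>G'.
        moebius \<tau> (as' ! k) = as ! j \<and> \<sigma>s ! j = \<tau> ** (\<sigma>s' ! k))"


section \<open>Finite dimensional unitary representations\<close>

text \<open>A finite dimensional Hermitian space is a subspace \<open>vecs\<close> of an ambient complex vector space,
  with an inner product that is linear in the first argument and is relevant on \<open>vecs\<close> only.
  The explicit carrier makes room for the representation space of an induced representation.\<close>

record 'v hermitian =
  vecs :: "'v set"
  smul :: "complex \<Rightarrow> 'v \<Rightarrow> 'v"
  ip :: "'v \<Rightarrow> 'v \<Rightarrow> complex"

definition hermitian_space :: "'v::ab_group_add hermitian \<Rightarrow> bool" where
  "hermitian_space H \<longleftrightarrow>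
     vector_space (smul H) \<and> module.subspace (smul H) (vecs H) \<and>
     (\<exists>B. finite B \<and> vecs H = module.span (smul H) B) \<and>
     (\<forall>u\<in>vecs H. \<forall>v\<in>vecs H. \<forall>w\<in>vecs H. ip H (u + v) w = ip H u w + ip H v w) \<and>
     (\<forall>c. \<forall>u\<in>vecs H. \<forall>w\<in>vecs H. ip H (smul H c u) w = c * ip H u w) \<and>
     (\<forall>u\<in>vecs H. \<forall>w\<in>vecs H. ip H w u = cnj (ip H u w)) \<and>
     (\<forall>u\<in>vecs H. u \<noteq> 0 \<longrightarrow> 0 < Re (ip H u u))"

definition unitary_rep ::
  "cmat2 set \<Rightarrow> 'v::ab_group_add hermitian \<Rightarrow> (cmat2 \<Rightarrow> 'v \<Rightarrow> 'v) \<Rightarrow> bool" where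
  "unitary_rep G H \<rho> \<longleftrightarrow>
     (\<forall>g\<in>G. \<forall>v\<in>vecs H. \<rho> g v \<in> vecs H) \<and>
     (\<forall>g\<in>G. \<forall>u\<in>vecs H. \<forall>v\<in>vecs H. \<rho> g (u + v) = \<rho> g u + \<rho> g v) \<and>
     (\<forall>g\<in>G. \<forall>c. \<forall>v\<in>vecs H. \<rho> g (smul H c v) = smul H c (\<rho> g v)) \<and>
     (\<forall>g\<in>G. \<forall>u\<in>vecs H. \<forall>v\<in>vecs H. ip H (\<rho> g u) (\<rho> g v) = ip H u v) \<and>
     (\<forall>v\<in>vecs H. \<rho> (Finite_Cartesian_Product.mat 1) v = v) \<and>
     (\<forall>g\<in>G. \<forall>h\<in>G. \<forall>v\<in>vecs H. \<rho> (g ** h) v = \<rho> g (\<rho> h v))"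

definition singular_space ::
  "cmat2 set \<Rightarrow> 'v hermitian \<Rightarrow> (cmat2 \<Rightarrow> 'v \<Rightarrow> 'v) \<Rightarrow> complex option \<Rightarrow> 'v set" where
  "singular_space G H \<rho> \<zeta> = {v \<in> vecs H. \<forall>g\<in>cusp_stabilizer G \<zeta>. \<rho> g v = v}"

definition orthonormal_basis :: "'v::ab_group_add hermitian \<Rightarrow> 'v set \<Rightarrow> 'v list \<Rightarrow> bool" where
  "orthonormal_basis H W B \<longleftrightarrow> module.span (smul H) (set B) = W \<and>
     (\<forall>l<length B. \<forall>m<length B. ip H (B ! l) (B ! m) = (if l = m then 1 else 0))"

definition singular_bases ::
  "cmat2 set \<Rightarrow> 'v::ab_group_add hermitian \<Rightarrow> (cmat2 \<Rightarrow> 'v \<Rightarrow> 'v) \<Rightarrow> complex option list \<Rightarrow>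
   'v list list \<Rightarrow> bool" where
  "singular_bases G H \<rho> as Bs \<longleftrightarrow> length Bs = length as \<and>
     (\<forall>j<length as. orthonormal_basis H (singular_space G H \<rho> (as ! j)) (Bs ! j))"

abbreviation right_cosets :: "cmat2 set \<Rightarrow> cmat2 set \<Rightarrow> cmat2 set set" where
  "right_cosets K G \<equiv> rcosets\<^bsub>SL2C\<lparr>carrier := G\<rparr>\<^esub> K"

text \<open>\<open>induced_space\<close> consists of the functions \<open>f\<close> on \<open>G'\<close> with
  \<open>f (\<gamma> x) = \<eta> \<gamma> (f x)\<close> for \<open>\<gamma> \<in> G\<close>, extended by zero outside \<open>G'\<close>. As \<open>\<eta>\<close> is unitary, the summand of
  the inner product depends only on the coset \<open>G x\<close>. The group \<open>G'\<close> acts by right translation.\<close>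

definition induced_space ::
  "cmat2 set \<Rightarrow> cmat2 set \<Rightarrow> 'v::ab_group_add hermitian \<Rightarrow> (cmat2 \<Rightarrow> 'v \<Rightarrow> 'v) \<Rightarrow>
   (cmat2 \<Rightarrow> 'v) hermitian" where
  "induced_space G' G H \<eta> =
     \<lparr>vecs = {f. (\<forall>x\<in>G'. f x \<in> vecs H) \<and> (\<forall>x. x \<notin> G' \<longrightarrow> f x = 0) \<and>
                 (\<forall>\<gamma>\<in>G. \<forall>x\<in>G'. f (\<gamma> ** x) = \<eta> \<gamma> (f x))},
      smul = (\<lambda>c f x. smul H c (f x)),
      ip = (\<lambda>f h. \<Sum>C\<in>right_cosets G G'. ip H (f (SOME x. x \<in> C)) (h (SOME x. x \<in> C)))\<rparr>"

definition induced_rep :: "cmat2 \<Rightarrow> (cmat2 \<Rightarrow> 'v) \<Rightarrow> (cmat2 \<Rightarrow> 'v)" where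
  "induced_rep g f = (\<lambda>x. f (x ** g))"


section \<open>Eisenstein series and the scattering function\<close>

text \<open>\<open>E\<close> is the meromorphic continuation in \<open>s\<close> of the Eisenstein series attached to the cusp \<open>\<zeta>\<close>, the
  scaling matrix \<open>\<sigma>\<close> and the singular vector \<open>v\<close>. Convergence, which for \<^const>\<open>has_sum\<close> in the complex
  numbers is absolute, and meromorphy of functions with values in \<open>vecs H\<close> are expressed through
  their coordinates \<open>ip H _ w\<close>; the space being finite dimensional, this is no restriction. The
  summand does not depend on the representative \<open>g\<close> of the coset \<open>C\<close>.\<close>

definition eisenstein_continuation ::
  "cmat2 set \<Rightarrow> 'v hermitian \<Rightarrow> (cmat2 \<Rightarrow> 'v \<Rightarrow> 'v) \<Rightarrow> complex option \<Rightarrow> cmat2 \<Rightarrow> 'v \<Rightarrow>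
   (hpoint \<Rightarrow> complex \<Rightarrow> 'v) \<Rightarrow> bool" where
  "eisenstein_continuation G H \<rho> \<zeta> \<sigma> v E \<longleftrightarrow>
     (\<forall>\<omega>\<in>H3. (\<forall>s. E \<omega> s \<in> vecs H) \<and>
       (\<forall>w\<in>vecs H.
          (\<lambda>s. ip H (E \<omega> s) w) meromorphic_on UNIV \<and>
          (\<forall>s. 2 < Re s \<longrightarrow>
             ((\<lambda>C. let g = (SOME g. g \<in> C) in
                complex_of_real (snd (hyp_act (inv\<^bsub>SL2C\<^esub> \<sigma> ** g) \<omega>)) powr s
                  * ip H (\<rho> (inv\<^bsub>SL2C\<^esub> g) v) w)
              has_sum ip H (E \<omega> s) w) (right_cosets (cusp_stabilizer G \<zeta>) G))))"

definition eisenstein_index :: "'v list list \<Rightarrow> (nat \<times> nat) list" where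
  "eisenstein_index Bs = [(j, l). j \<leftarrow> [0..<length Bs], l \<leftarrow> [0..<length (Bs ! j)]]"

text \<open>Identities of meromorphic functions hold outside a closed discrete subset of the complex
  numbers, where the value of the function is irrelevant.\<close>

definition scattering_matrix ::
  "cmat2 set \<Rightarrow> 'v::ab_group_add hermitian \<Rightarrow> (cmat2 \<Rightarrow> 'v \<Rightarrow> 'v) \<Rightarrow> complex option list \<Rightarrow> cmat2 list \<Rightarrow>
   'v list list \<Rightarrow> (complex \<Rightarrow> complex Matrix.mat) \<Rightarrow> bool" where
  "scattering_matrix G H \<rho> as \<sigma>s Bs S \<longleftrightarrow>
     (let I = eisenstein_index Bs; n = length I in
       (\<forall>s. S s \<in> carrier_mat n n) \<and>
       (\<forall>i<n. \<forall>k<n. (\<lambda>s. S s $$ (i, k)) meromorphic_on UNIV) \<and>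
       (\<exists>E. (\<forall>(j, l)\<in>set I.
               eisenstein_continuation G H \<rho> (as ! j) (\<sigma>s ! j) (Bs ! j ! l) (E (j, l))) \<and>
            (\<forall>i<n. \<forall>\<omega>\<in>H3. \<forall>\<^sub>\<approx>s\<in>UNIV.
               E (I ! i) \<omega> s = (\<Sum>k<n. smul H (S s $$ (i, k)) (E (I ! k) \<omega> (2 - s))))))"

text \<open>The scattering function is the determinant of the scattering matrix, as a meromorphic function:
  \<^const>\<open>remove_sings\<close> yields the representative that is continuous away from the poles and
  vanishes at the poles. So equality of scattering functions is equality of meromorphic functions.\<close>

definition scattering_function ::
  "cmat2 set \<Rightarrow> 'v::ab_group_add hermitian \<Rightarrow> (cmat2 \<Rightarrow> 'v \<Rightarrow> 'v) \<Rightarrow> complex option list \<Rightarrow> cmat2 list \<Rightarrow>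
   'v list list \<Rightarrow> complex \<Rightarrow> complex" where
  "scattering_function G H \<rho> as \<sigma>s Bs =
     (THE \<phi>. \<exists>S. scattering_matrix G H \<rho> as \<sigma>s Bs S \<and>
                 \<phi> = remove_sings (\<lambda>s. Determinant.det (S s)))"

end

theory Submission
  imports Defs
begin

text \<open>Let \<open>\<zeta>\<^sub>k\<close> be a cusp of the larger group \<open>\<Gamma>'\<close> and \<open>f\<close> a singular vector of the induced representation at
  \<open>\<zeta>\<^sub>k\<close>. As a function on \<open>\<Gamma>'\<close> it is right invariant under the stabilizer of \<open>\<zeta>\<^sub>k\<close>, so it is a function
  of the boundary point \<open>x \<zeta>\<^sub>k\<close>. Since the index is finite, the \<open>\<Gamma>'\<close>-orbit of \<open>\<zeta>\<^sub>k\<close> is the disjoint union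
  of the \<open>\<Gamma>\<close>-orbits of those cusps \<open>\<tau>\<^sub>j \<zeta>\<^sub>k\<close> of \<open>\<Gamma>\<close> that lie over \<open>\<zeta>\<^sub>k\<close>
  (\<open>orbit_decomposition\<close>), and on the orbit of the cusp \<open>j\<close> the vector \<open>f\<close> is determined by the value
  \<open>f(\<tau>\<^sub>j)\<close>, which is singular at that cusp. Hence \<open>f \<mapsto> (f(\<tau>\<^sub>j))\<^sub>j\<close> identifies the singular space at \<open>\<zeta>\<^sub>k\<close>
  with the direct sum of the singular spaces of the cusps over \<open>\<zeta>\<^sub>k\<close>; the inverse is given by
  \<open>lift\<close> (\<open>lift_value\<close>, \<open>sing'_decomposition\<close>).

  An Eisenstein series is a sum over the orbit of its cusp (\<open>has_sum_cosets_iff_orbit\<close>). With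
  compatible scaling matrices the summands of the two groups agree, and splitting the \<open>\<Gamma>'\<close>-orbit into
  \<open>\<Gamma>\<close>-orbits gives
  \<open>E'(\<omega>, s; f)(x) = \<Sum>\<^sub>j E\<^sub>j(x \<omega>, s; f(\<tau>\<^sub>j))\<close> (\<open>eisenstein_sum_induced\<close>, \<open>eisenstein_sum_restrict\<close>).
  So, evaluated at \<open>x = 1\<close>, the vector of all Eisenstein series of \<open>\<Gamma>'\<close> is a constant invertible matrix
  \<open>A\<close> times the vector of those of \<open>\<Gamma>\<close>.

  Consequently \<open>S \<mapsto> A S A\<^sup>-\<^sup>1\<close> takes scattering matrices of \<open>\<Gamma>\<close> to scattering matrices of \<open>\<Gamma>'\<close>, its
  inverse takes them back, and determinants are preserved. The identification of singular spaces is
  not isometric: norms on the induced space weigh the cusp \<open>j\<close> by the number of cosets of \<open>\<Gamma>\<close> in its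
  double coset. This does no harm, because conjugation by any invertible matrix preserves the
  determinant.\<close>

(* From here on the dollar sign stands for the entries of vectors and matrices. *)
no_notation fps_nth (infixl "$" 75)

section \<open>The group SL(2,C) and its actions\<close>

abbreviation I2 :: cmat2 where
  "I2 \<equiv> Finite_Cartesian_Product.mat 1"

lemma in_SL2C: "A \<in> carrier SL2C \<longleftrightarrow> Determinants.det A = 1"
  by (simp add: SL2C_def)

lemma mult_SL2C: "A \<otimes>\<^bsub>SL2C\<^esub> B = A ** B"
  by (simp add: SL2C_def)

lemma one_SL2C: "\<one>\<^bsub>SL2C\<^esub> = I2"
  by (simp add: SL2C_def)

lemma group_SL2C: "group SL2C"
proof (rule groupI)
  fix A assume A: "A \<in> carrier SL2C"
  then have "invertible A"
    by (simp add: in_SL2C invertible_det_nz)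
  then obtain B where B: "A ** B = I2" "B ** A = I2"
    by (auto simp: invertible_def)
  then have "Determinants.det B * Determinants.det A = 1"
    by (metis det_mul det_I)
  then have "B \<in> carrier SL2C"
    using A by (simp add: in_SL2C)
  then show "\<exists>B\<in>carrier SL2C. B \<otimes>\<^bsub>SL2C\<^esub> A = \<one>\<^bsub>SL2C\<^esub>"
    using B by (auto simp: mult_SL2C one_SL2C)
qed (auto simp: in_SL2C mult_SL2C one_SL2C det_mul matrix_mul_assoc)

interpretation SL2C: group SL2C
  by (rule group_SL2C)

abbreviation SL2C_inv :: "cmat2 \<Rightarrow> cmat2" where
  "SL2C_inv A \<equiv> inv\<^bsub>SL2C\<^esub> A"

lemmas SL2C_simps = mult_SL2C one_SL2C

lemma SL2C_closed [simp]:
  "A \<in> carrier SL2C \<Longrightarrow> B \<in> carrier SL2C \<Longrightarrow> A ** B \<in> carrier SL2C"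
  "I2 \<in> carrier SL2C"
  using SL2C.m_closed[of A B] SL2C.one_closed by (simp_all add: SL2C_simps)

lemma SL2C_inverse [simp]:
  assumes "A \<in> carrier SL2C"
  shows "A ** SL2C_inv A = I2" "SL2C_inv A ** A = I2"
    and "B ** A ** SL2C_inv A = B" "B ** SL2C_inv A ** A = B"
proof -
  show *: "A ** SL2C_inv A = I2" "SL2C_inv A ** A = I2"
    using SL2C.r_inv[OF assms] SL2C.l_inv[OF assms] by (simp_all add: SL2C_simps)
  show "B ** A ** SL2C_inv A = B" "B ** SL2C_inv A ** A = B"
    by (simp_all add: * flip: matrix_mul_assoc)
qed

lemma SL2C_inv_mult:
  "A \<in> carrier SL2C \<Longrightarrow> B \<in> carrier SL2C \<Longrightarrow> SL2C_inv (A ** B) = SL2C_inv B ** SL2C_inv A"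
  using SL2C.inv_mult_group[of A B] by (simp add: SL2C_simps)

lemma matrix_mult_2:
  fixes A B :: cmat2
  shows "(A ** B)$i$j = A$i$1 * B$1$j + A$i$2 * B$2$j"
  by (simp add: matrix_matrix_mult_def UNIV_2)

lemma cmat2_eqI:
  fixes A B :: cmat2
  assumes "A$1$1 = B$1$1" "A$1$2 = B$1$2" "A$2$1 = B$2$1" "A$2$2 = B$2$2"
  shows "A = B"
  using assms by (simp add: Finite_Cartesian_Product.vec_eq_iff forall_2)

lemma mat_entries [simp]: "I2$1$1 = 1" "I2$1$2 = 0" "I2$2$1 = 0" "I2$2$2 = 1"
  by (simp_all add: Finite_Cartesian_Product.mat_def)

lemma subgroup_SL2C:
  assumes "subgroup G SL2C"
  shows "I2 \<in> G" "g \<in> G \<Longrightarrow> h \<in> G \<Longrightarrow> g ** h \<in> G" "g \<in> G \<Longrightarrow> SL2C_inv g \<in> G"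
    "g \<in> G \<Longrightarrow> g \<in> carrier SL2C"
  using subgroup.one_closed[OF assms] subgroup.m_closed[OF assms, of g h]
    subgroup.m_inv_closed[OF assms, of g] subgroup.subset[OF assms]
  by (auto simp: SL2C_simps)

lemma moebius_I2 [simp]: "moebius I2 \<zeta> = \<zeta>"
  by (simp add: moebius_def split: option.split)

lemma moebius_mult:
  assumes A: "A \<in> carrier SL2C" and B: "B \<in> carrier SL2C"
  shows "moebius (A ** B) \<zeta> = moebius A (moebius B \<zeta>)"
proof -
  have dA: "A$1$1 * A$2$2 - A$1$2 * A$2$1 = 1" and dB: "B$1$1 * B$2$2 - B$1$2 * B$2$1 = 1"
    using A B by (simp_all add: in_SL2C Determinants.det_2)
  have *: "moebius (A ** B) (Some z) = moebius A (Some (p / q))"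
    if "q \<noteq> 0" "p = B$1$1 * z + B$1$2" "q = B$2$1 * z + B$2$2" for z p q
  proof -
    have "A$2$1 * (p / q) + A$2$2 = (A$2$1 * p + A$2$2 * q) / q"
         "A$1$1 * (p / q) + A$1$2 = (A$1$1 * p + A$1$2 * q) / q"
      using that(1) by (simp_all add: field_simps)
    moreover have "(A ** B)$2$1 * z + (A ** B)$2$2 = A$2$1 * p + A$2$2 * q"
      "(A ** B)$1$1 * z + (A ** B)$1$2 = A$1$1 * p + A$1$2 * q"
      by (simp_all add: matrix_mult_2 that(2,3) algebra_simps)
    ultimately show ?thesis
      using that(1) by (simp add: moebius_def)
  qed
  have **: "moebius (A ** B) (Some z) = moebius A None" if "B$2$1 * z + B$2$2 = 0" for z
  proof -
    define p where "p = B$1$1 * z + B$1$2"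
    have "B$2$1 * p = B$1$1 * (B$2$1 * z + B$2$2) - 1"
      using dB by (simp add: p_def algebra_simps)
    then have "p \<noteq> 0"
      using that by auto
    moreover have "(A ** B)$2$1 * z + (A ** B)$2$2 = A$2$1 * p + A$2$2 * (B$2$1 * z + B$2$2)"
      "(A ** B)$1$1 * z + (A ** B)$1$2 = A$1$1 * p + A$1$2 * (B$2$1 * z + B$2$2)"
      by (simp_all add: matrix_mult_2 p_def algebra_simps)
    ultimately show ?thesis
      using that by (simp add: moebius_def)
  qed
  show ?thesis
  proof (cases \<zeta>)
    case (Some z)
    then show ?thesis
      using *[OF _ refl refl, of z] **[of z] by (cases "B$2$1 * z + B$2$2 = 0") (auto simp: moebius_def[of B])
  next
    case None
    show ?thesis
    proof (cases "B$2$1 = 0")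
      case True
      then have "B$1$1 \<noteq> 0"
        using dB by auto
      then show ?thesis
        using True None by (simp add: moebius_def matrix_mult_2)
    next
      case False
      then have "A$2$1 * (B$1$1 / B$2$1) + A$2$2 = (A ** B)$2$1 / B$2$1"
        "A$1$1 * (B$1$1 / B$2$1) + A$1$2 = (A ** B)$1$1 / B$2$1"
        by (simp_all add: matrix_mult_2 field_simps)
      then show ?thesis
        using False None by (simp add: moebius_def)
    qed
  qed
qed

lemma moebius_inv [simp]:
  assumes "A \<in> carrier SL2C"
  shows "moebius A (moebius (SL2C_inv A) \<zeta>) = \<zeta>" "moebius (SL2C_inv A) (moebius A \<zeta>) = \<zeta>"
  using assms by (simp_all flip: moebius_mult)

lemma moebius_eq_iff:
  assumes "A \<in> carrier SL2C"
  shows "moebius A \<zeta> = \<xi> \<longleftrightarrow> \<zeta> = moebius (SL2C_inv A) \<xi>"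
  using assms by auto

text \<open>The group acts transitively on the boundary, so a fixed point may be moved to infinity.\<close>

lemma exists_scaling:
  obtains \<sigma> where "\<sigma> \<in> carrier SL2C" "moebius \<sigma> None = \<zeta>"
proof (cases \<zeta>)
  case None
  then show ?thesis
    using that[of I2] by simp
next
  case (Some z)
  define \<sigma> :: cmat2 where "\<sigma> = vector [vector [z, -1], vector [1, 0]]"
  have "\<sigma> \<in> carrier SL2C" "moebius \<sigma> None = \<zeta>"
    by (simp_all add: \<sigma>_def in_SL2C Determinants.det_2 moebius_def Some)
  then show ?thesis
    by (rule that)
qed

lemma hyp_act_denominator_pos:
  fixes A :: cmat2
  assumes "A \<in> carrier SL2C" "0 < y"
  shows "0 < (cmod (A$2$1 * z + A$2$2))\<^sup>2 + (cmod (A$2$1))\<^sup>2 * y\<^sup>2"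
proof (cases "A$2$1 = 0")
  case True
  then have "A$2$2 \<noteq> 0"
    using assms(1) by (auto simp: in_SL2C Determinants.det_2)
  then show ?thesis
    using True by simp
next
  case False
  then show ?thesis
    using assms(2) by (intro add_nonneg_pos) auto
qed

lemma hyp_act_in_H3:
  assumes "A \<in> carrier SL2C" "\<omega> \<in> H3"
  shows "hyp_act A \<omega> \<in> H3"
  using assms hyp_act_denominator_pos[OF assms(1), of "snd \<omega>" "fst \<omega>"]
  by (auto simp: H3_def hyp_act_def Let_def)

lemma lagrange_complex:
  fixes X Y Q q :: complex
  shows "(cmod (X * cnj Q + Y * cnj q))\<^sup>2 + (cmod (X * q - Y * Q))\<^sup>2
       = ((cmod Q)\<^sup>2 + (cmod q)\<^sup>2) * ((cmod X)\<^sup>2 + (cmod Y)\<^sup>2)"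
  unfolding cmod_power2 by (simp add: power2_eq_square algebra_simps)

text \<open>With \<open>N\<^sub>A(\<omega>) = |c z + d|\<^sup>2 + |c|\<^sup>2 y\<^sup>2\<close> the claim is \<open>N\<^sub>A\<^sub>B(\<omega>) = N\<^sub>A(B \<omega>) N\<^sub>B(\<omega>)\<close>. Put
  \<open>P = a z + b\<close>, \<open>Q = c z + d\<close>, \<open>p = a y\<close>, \<open>q = c y\<close> for the entries of \<open>B\<close>, and let \<open>c', d'\<close> be the lower
  row of \<open>A\<close>. The claim is then Lagrange's identity for the vectors \<open>(Q, q)\<close> and
  \<open>(c' P + d' Q, c' p + d' q)\<close>, whose cross product is \<open>c' (P q - p Q) = - c' y\<close>.\<close>

lemma height_mult:
  assumes A: "A \<in> carrier SL2C" and B: "B \<in> carrier SL2C" and \<omega>: "\<omega> \<in> H3"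
  shows "snd (hyp_act (A ** B) \<omega>) = snd (hyp_act A (hyp_act B \<omega>))"
proof -
  obtain z y where zy: "\<omega> = (z, y)" "0 < y"
    using \<omega> by (auto simp: H3_def)
  define a b c d where "a = B$1$1" and "b = B$1$2" and "c = B$2$1" and "d = B$2$2"
  define c' d' where "c' = A$2$1" and "d' = A$2$2"
  define P Q p q where "P = a * z + b" and "Q = c * z + d" and "p = a * of_real y" and "q = c * of_real y"
  define N where "N = (cmod Q)\<^sup>2 + (cmod q)\<^sup>2"
  define Z where "Z = P * cnj Q + p * cnj q"
  define X Y where "X = c' * P + d' * Q" and "Y = c' * p + d' * q"
  have N: "0 < N"
    using hyp_act_denominator_pos[OF B zy(2), of z] zy(2)
    by (simp add: N_def Q_def q_def c_def d_def norm_mult power_mult_distrib)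
  have det: "a * d - b * c = 1"
    using B by (simp add: in_SL2C Determinants.det_2 a_def b_def c_def d_def)
  have cross: "X * q - Y * Q = - c' * of_real y"
  proof -
    have "X * q - Y * Q = - c' * of_real y * (a * d - b * c)"
      by (simp add: X_def Y_def P_def Q_def p_def q_def algebra_simps)
    then show ?thesis
      by (simp add: det)
  qed
  have ZN: "c' * Z + d' * of_real N = X * cnj Q + Y * cnj q"
    unfolding N_def of_real_add complex_norm_square
    by (simp add: X_def Y_def Z_def algebra_simps)
  have lag: "(cmod (c' * Z + d' * of_real N))\<^sup>2 + (cmod c')\<^sup>2 * y\<^sup>2 = N * ((cmod X)\<^sup>2 + (cmod Y)\<^sup>2)"
  proof -
    have e: "(cmod (X * q - Y * Q))\<^sup>2 = (cmod c')\<^sup>2 * y\<^sup>2"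
      by (simp add: cross norm_mult power_mult_distrib)
    have "(cmod (X * cnj Q + Y * cnj q))\<^sup>2 + (cmod (X * q - Y * Q))\<^sup>2 = N * ((cmod X)\<^sup>2 + (cmod Y)\<^sup>2)"
      unfolding N_def by (rule lagrange_complex)
    then show ?thesis
      unfolding ZN e .
  qed
  have 1: "hyp_act B \<omega> = (Z / of_real N, y / N)"
    by (simp add: hyp_act_def zy Let_def a_def b_def c_def d_def N_def Z_def P_def Q_def p_def q_def
        norm_mult power_mult_distrib power2_eq_square abs_of_pos[OF zy(2)] algebra_simps)
  have 2: "(cmod (c' * (Z / of_real N) + d'))\<^sup>2 + (cmod c')\<^sup>2 * (y / N)\<^sup>2
      = ((cmod X)\<^sup>2 + (cmod Y)\<^sup>2) / N"
  proof -
    have "c' * (Z / of_real N) + d' = (c' * Z + d' * of_real N) / of_real N"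
      using N by (simp add: field_simps)
    then have "(cmod (c' * (Z / of_real N) + d'))\<^sup>2 = (cmod (c' * Z + d' * of_real N))\<^sup>2 / N\<^sup>2"
      using N by (simp add: norm_divide power_divide)
    then have "(cmod (c' * (Z / of_real N) + d'))\<^sup>2 + (cmod c')\<^sup>2 * (y / N)\<^sup>2
       = ((cmod (c' * Z + d' * of_real N))\<^sup>2 + (cmod c')\<^sup>2 * y\<^sup>2) / N\<^sup>2"
      by (simp add: power_divide add_divide_distrib)
    also have "\<dots> = ((cmod X)\<^sup>2 + (cmod Y)\<^sup>2) / N"
      unfolding lag using N by (simp add: power2_eq_square)
    finally show ?thesis .
  qed
  have 3: "snd (hyp_act (A ** B) \<omega>) = y / ((cmod X)\<^sup>2 + (cmod Y)\<^sup>2)"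
  proof -
    have "(A ** B)$2$1 * z + (A ** B)$2$2 = X" "(A ** B)$2$1 * of_real y = Y"
      by (simp_all add: matrix_mult_2 X_def Y_def P_def Q_def p_def q_def a_def b_def c_def d_def
          c'_def d'_def algebra_simps)
    moreover from this(2) have "(cmod ((A ** B)$2$1))\<^sup>2 * y\<^sup>2 = (cmod Y)\<^sup>2"
      using zy(2) by (metis norm_mult norm_of_real power_mult_distrib power2_abs)
    ultimately show ?thesis
      by (simp add: hyp_act_def zy Let_def)
  qed
  show ?thesis
    unfolding 3 1 using N 2 by (simp add: hyp_act_def Let_def c'_def d'_def)
qed

section \<open>Stabilizers of cusps\<close>

text \<open>For \<open>e = \<plusminus>1\<close> these are the translations fixing infinity, up to sign. With the factor \<open>e\<close> in the
  corner, products multiply the signs and add the translations.\<close>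

definition shear :: "complex \<Rightarrow> complex \<Rightarrow> cmat2" where
  "shear e t = (\<chi> i j. if i = j then e else if i = 1 then e * t else 0)"

lemma shear_entries [simp]:
  "shear e t $1$1 = e" "shear e t $1$2 = e * t" "shear e t $2$1 = 0" "shear e t $2$2 = e"
  by (simp_all add: shear_def)

lemma shear_mult: "shear e t ** shear e' t' = shear (e * e') (t + t')"
  by (rule cmat2_eqI) (simp_all add: matrix_mult_2 algebra_simps)

lemma shear_SL2C: "shear e t \<in> carrier SL2C \<longleftrightarrow> e\<^sup>2 = 1"
  by (simp add: in_SL2C Determinants.det_2 power2_eq_square)

lemma moebius_None_eq_None: "moebius A None = None \<longleftrightarrow> A$2$1 = 0"
  by (simp add: moebius_def Let_def)

lemma trace_conj_SL2C:
  assumes "\<sigma> \<in> carrier SL2C"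
  shows "trace (\<sigma> ** A ** SL2C_inv \<sigma>) = trace A"
  using trace_mul_sym[of "\<sigma> ** A" "SL2C_inv \<sigma>"] assms by (simp add: matrix_mul_assoc)

lemma conj_SL2C_cancel:
  assumes "\<sigma> \<in> carrier SL2C"
  shows "\<sigma> ** (SL2C_inv \<sigma> ** A ** \<sigma>) ** SL2C_inv \<sigma> = A"
  using assms by (simp add: matrix_mul_assoc)

lemma conj_SL2C_mult:
  assumes "\<sigma> \<in> carrier SL2C"
  shows "(\<sigma> ** A ** SL2C_inv \<sigma>) ** (\<sigma> ** B ** SL2C_inv \<sigma>) = \<sigma> ** (A ** B) ** SL2C_inv \<sigma>"
  using assms by (simp add: matrix_mul_assoc)

lemma conj_center:
  assumes "\<sigma> \<in> carrier SL2C"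
  shows "\<sigma> ** I2 ** SL2C_inv \<sigma> = I2" "\<sigma> ** (- I2) ** SL2C_inv \<sigma> = - I2"
    "SL2C_inv \<sigma> ** I2 ** \<sigma> = I2" "SL2C_inv \<sigma> ** (- I2) ** \<sigma> = - I2"
proof -
  have neg: "A ** (- I2) ** B = - (A ** B)" for A B :: cmat2
    by (rule cmat2_eqI) (simp_all add: matrix_mult_2)
  show "\<sigma> ** I2 ** SL2C_inv \<sigma> = I2" "\<sigma> ** (- I2) ** SL2C_inv \<sigma> = - I2"
    "SL2C_inv \<sigma> ** I2 ** \<sigma> = I2" "SL2C_inv \<sigma> ** (- I2) ** \<sigma> = - I2"
    using assms by (simp_all add: neg)
qed

text \<open>Moved to infinity, a parabolic element is upper triangular with determinant one and trace \<open>\<plusminus>2\<close>,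
  which forces its two diagonal entries to coincide.\<close>

lemma parabolic_eq_shear:
  assumes g: "parabolic g" "moebius g \<zeta> = \<zeta>" and \<sigma>: "\<sigma> \<in> carrier SL2C" "moebius \<sigma> None = \<zeta>"
  obtains e t where "e\<^sup>2 = 1" "t \<noteq> 0" "g = \<sigma> ** shear e t ** SL2C_inv \<sigma>"
proof -
  have gc: "g \<in> carrier SL2C" and g1: "g \<noteq> I2" "g \<noteq> - I2" and tr: "trace g = 2 \<or> trace g = - 2"
    using g(1) by (auto simp: parabolic_def)
  define X where "X = SL2C_inv \<sigma> ** g ** \<sigma>"
  have gX: "g = \<sigma> ** X ** SL2C_inv \<sigma>"
    unfolding X_def by (rule conj_SL2C_cancel[OF \<sigma>(1), symmetric])
  have X: "X \<in> carrier SL2C"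
    using gc \<sigma> by (simp add: X_def)
  have "moebius X None = None"
    using gc \<sigma> g(2) by (simp add: X_def moebius_mult) (metis moebius_inv(2))
  then have c0: "X$2$1 = 0"
    by (simp add: moebius_None_eq_None)
  have det: "X$1$1 * X$2$2 = 1"
    using X c0 by (simp add: in_SL2C Determinants.det_2)
  have "trace X = trace g"
    using trace_conj_SL2C[OF \<sigma>(1), of X] gX by simp
  then have "X$1$1 + X$2$2 = 2 \<or> X$1$1 + X$2$2 = - 2"
    using tr by (simp add: trace_def UNIV_2)
  then have "(X$1$1 + X$2$2)\<^sup>2 = 4"
    by auto
  then have "(X$1$1 - X$2$2)\<^sup>2 = 0"
    using det by (simp add: power2_eq_square algebra_simps)
  then have eq: "X$2$2 = X$1$1"
    by simp
  define e t where "e = X$1$1" and "t = X$1$2 / e"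
  have e: "e\<^sup>2 = 1"
    using det eq by (simp add: e_def power2_eq_square)
  then have "e \<noteq> 0"
    by auto
  then have Xs: "X = shear e t"
    by (intro cmat2_eqI) (simp_all add: t_def c0 eq e_def)
  have "t \<noteq> 0"
  proof
    assume t: "t = 0"
    have "e = 1 \<or> e = -1"
      using e by (simp add: power2_eq_1_iff)
    then have "X = I2 \<or> X = - I2"
      using t Xs by (auto intro!: cmat2_eqI)
    then show False
      using gX g1 conj_center[OF \<sigma>(1)] by auto
  qed
  then show ?thesis
    using that e gX Xs by blast
qed

lemma parabolic_shear:
  assumes \<sigma>: "\<sigma> \<in> carrier SL2C" and e: "e\<^sup>2 = 1" and t: "t \<noteq> 0"
  shows "parabolic (\<sigma> ** shear e t ** SL2C_inv \<sigma>)"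
proof -
  have e1: "e = 1 \<or> e = -1"
    using e by (simp add: power2_eq_1_iff)
  have ne: "\<sigma> ** shear e t ** SL2C_inv \<sigma> \<noteq> A"
    if "SL2C_inv \<sigma> ** A ** \<sigma> = B" "B$1$2 = 0" for A B
  proof
    assume "\<sigma> ** shear e t ** SL2C_inv \<sigma> = A"
    then have "B = shear e t"
      using \<sigma> that(1) by (auto simp: matrix_mul_assoc)
    then show False
      using that(2) t e1 by auto
  qed
  have "SL2C_inv \<sigma> ** I2 ** \<sigma> = I2" "SL2C_inv \<sigma> ** (- I2) ** \<sigma> = - I2"
    by (rule conj_center[OF \<sigma>])+
  moreover have "trace (\<sigma> ** shear e t ** SL2C_inv \<sigma>) = e + e"
    unfolding trace_conj_SL2C[OF \<sigma>] by (simp add: trace_def UNIV_2)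
  ultimately show ?thesis
    using \<sigma> e e1 ne by (auto simp: parabolic_def shear_SL2C)
qed

text \<open>If \<open>h\<close> acts near the cusp as \<open>z \<mapsto> a\<^sup>2 z + a b\<close> with \<open>|a| < 1\<close>, then conjugating a translation by the
  powers of \<open>h\<close> yields translations by \<open>a\<^sup>2\<^sup>n u\<close>, which accumulate at the identity. This contradicts
  discreteness.\<close>

lemma contraction_not_in_stabilizer:
  assumes G: "subgroup G SL2C" "discrete G" and p: "p \<in> G" "parabolic p" "moebius p \<zeta> = \<zeta>"
    and h: "h \<in> G" "moebius h \<zeta> = \<zeta>" and \<sigma>: "\<sigma> \<in> carrier SL2C" "moebius \<sigma> None = \<zeta>"
  shows "\<not> cmod ((SL2C_inv \<sigma> ** h ** \<sigma>)$1$1) < 1"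
proof
  define X where "X = SL2C_inv \<sigma> ** h ** \<sigma>"
  define a where "a = X$1$1"
  assume "cmod ((SL2C_inv \<sigma> ** h ** \<sigma>)$1$1) < 1"
  then have a: "cmod a < 1"
    by (simp add: a_def X_def)
  note G_simps = subgroup_SL2C[OF G(1)]
  have hc: "h \<in> carrier SL2C"
    using h(1) G_simps by blast
  obtain e t where e: "e\<^sup>2 = 1" and t: "t \<noteq> 0" and pe: "p = \<sigma> ** shear e t ** SL2C_inv \<sigma>"
    using parabolic_eq_shear[OF p(2,3) \<sigma>] .
  have X: "X \<in> carrier SL2C"
    using hc \<sigma> by (simp add: X_def)
  have "moebius X None = None"
    using hc \<sigma> h(2) by (simp add: X_def moebius_mult) (metis moebius_inv(2))
  then have c0: "X$2$1 = 0"
    by (simp add: moebius_None_eq_None)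
  then have det: "a * X$2$2 = 1"
    using X by (simp add: in_SL2C Determinants.det_2 a_def)
  define f where "f u = \<sigma> ** shear 1 u ** SL2C_inv \<sigma>" for u
  have f_step: "f (a\<^sup>2 * u) = h ** f u ** SL2C_inv h" for u
  proof -
    have "a * a * u * X$2$2 = a * u * (a * X$2$2)"
      by (simp add: algebra_simps)
    then have "X ** shear 1 u = shear 1 (a\<^sup>2 * u) ** X"
      using det by (intro cmat2_eqI) (simp_all add: matrix_mult_2 c0 power2_eq_square flip: a_def)
    then have "shear 1 (a\<^sup>2 * u) = X ** shear 1 u ** SL2C_inv X"
      using X by simp
    also have "\<dots> = SL2C_inv \<sigma> ** (h ** f u ** SL2C_inv h) ** \<sigma>"
      using hc \<sigma> by (simp add: X_def f_def SL2C_inv_mult matrix_mul_assoc)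
    finally show ?thesis
      using \<sigma> by (simp add: f_def[of "a\<^sup>2 * u"] matrix_mul_assoc)
  qed
  \<comment> \<open>The square of the parabolic element has sign one; it is translation by \<open>t + t\<close>.\<close>
  define u where "u n = (a\<^sup>2) ^ n * (t + t)" for n :: nat
  have u_G: "f (u n) \<in> G" for n
  proof (induction n)
    case 0
    have "f (u 0) = p ** p"
      using e by (simp add: f_def u_def pe conj_SL2C_mult[OF \<sigma>(1)] shear_mult power2_eq_square)
    then show ?case
      using p(1) by (simp add: G_simps)
  next
    case (Suc n)
    have "f (u (Suc n)) = h ** f (u n) ** SL2C_inv h"
      using f_step[of "u n"] by (simp add: u_def mult.assoc)
    then show ?case
      using Suc h(1) by (simp add: G_simps)
  qed
  have f_entry: "f v $ i $ j = I2$i$j + v * (\<sigma>$i$1 * SL2C_inv \<sigma>$2$j)" for v i j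
  proof -
    have "I2$i$j = (\<sigma> ** SL2C_inv \<sigma>)$i$j"
      using \<sigma> by simp
    then show ?thesis
      unfolding f_def matrix_mult_2 by (simp add: algebra_simps)
  qed
  have "a \<noteq> 0"
    using det by auto
  then have "u n \<noteq> 0" for n
    using t by (simp add: u_def)
  moreover have "f v \<noteq> I2" if "v \<noteq> 0" for v
  proof
    assume "f v = I2"
    then have "SL2C_inv \<sigma> ** f v ** \<sigma> = I2"
      using \<sigma> by simp
    then have "shear 1 v = I2"
      using \<sigma> by (simp add: f_def matrix_mul_assoc)
    then have "shear 1 v $1$2 = 0"
      by simp
    then show False
      using that by simp
  qed
  moreover have "(\<lambda>n. f (u n)) \<longlonglongrightarrow> I2"
  proof (intro vec_tendstoI)
    fix i j
    have "cmod (a\<^sup>2) < 1"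
      using a by (simp add: norm_power power_less_one_iff)
    then have "u \<longlonglongrightarrow> 0"
      unfolding u_def by (intro tendsto_mult_left_zero LIMSEQ_power_zero)
    then have "(\<lambda>n. I2$i$j + u n * (\<sigma>$i$1 * SL2C_inv \<sigma>$2$j)) \<longlonglongrightarrow> I2$i$j + 0 * (\<sigma>$i$1 * SL2C_inv \<sigma>$2$j)"
      by (intro tendsto_intros)
    then show "(\<lambda>n. f (u n) $ i $ j) \<longlonglongrightarrow> I2 $ i $ j"
      by (simp add: f_entry)
  qed
  ultimately have "filterlim (\<lambda>n. f (u n)) (at I2) sequentially"
    by (intro filterlim_atI) auto
  moreover have "\<forall>\<^sub>F y in at I2. y \<notin> G"
    using G(2) G_simps(1) by (simp add: discrete_altdef)
  ultimately have "\<forall>\<^sub>F n in sequentially. f (u n) \<notin> G"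
    by (rule eventually_compose_filterlim[rotated])
  then show False
    using u_G by simp
qed

text \<open>In coordinates with the cusp at infinity, a stabilizing element is \<open>z \<mapsto> a\<^sup>2 z + a b\<close>; neither it
  nor its inverse contracts, so \<open>a\<close> has modulus one and heights are preserved.\<close>

lemma cusp_stabilizer_height:
  assumes G: "subgroup G SL2C" "discrete G" "cusp G \<zeta>"
    and h: "h \<in> G" "moebius h \<zeta> = \<zeta>" and \<sigma>: "\<sigma> \<in> carrier SL2C" "moebius \<sigma> None = \<zeta>"
    and g: "g \<in> carrier SL2C" and \<omega>: "\<omega> \<in> H3"
  shows "snd (hyp_act (SL2C_inv \<sigma> ** (h ** g)) \<omega>) = snd (hyp_act (SL2C_inv \<sigma> ** g) \<omega>)"
proof -
  note G_simps = subgroup_SL2C[OF G(1)]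
  have hc: "h \<in> carrier SL2C"
    using h(1) G_simps by blast
  obtain p where p: "p \<in> G" "parabolic p" "moebius p \<zeta> = \<zeta>"
    using G(3) by (auto simp: cusp_def)
  define X where "X = SL2C_inv \<sigma> ** h ** \<sigma>"
  have X: "X \<in> carrier SL2C"
    using hc \<sigma> by (simp add: X_def)
  have "moebius X None = None"
    using hc \<sigma> h(2) by (simp add: X_def moebius_mult) (metis moebius_inv(2))
  then have c0: "X$2$1 = 0"
    by (simp add: moebius_None_eq_None)
  then have det: "X$1$1 * X$2$2 = 1"
    using X by (simp add: in_SL2C Determinants.det_2)
  have hi: "SL2C_inv h \<in> G" "moebius (SL2C_inv h) \<zeta> = \<zeta>"
    using h hc by (simp_all add: G_simps moebius_eq_iff[OF hc, symmetric] eq_commute[of _ \<zeta>])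
  have inv: "SL2C_inv \<sigma> ** SL2C_inv h ** \<sigma> = SL2C_inv X"
    using hc \<sigma> by (simp add: X_def SL2C_inv_mult matrix_mul_assoc)
  have "X ** SL2C_inv X = I2"
    using X by simp
  then have "(X ** SL2C_inv X)$2$1 = 0" "(X ** SL2C_inv X)$1$1 = 1"
    by simp_all
  then have "X$2$2 * SL2C_inv X$2$1 = 0" "X$1$1 * SL2C_inv X$1$1 + X$1$2 * SL2C_inv X$2$1 = 1"
    by (simp_all add: matrix_mult_2 c0)
  then have "X$1$1 * SL2C_inv X$1$1 = 1"
    using det by (metis add.right_neutral mult_eq_0_iff zero_neq_one)
  then have "X$1$1 * SL2C_inv X$1$1 = X$1$1 * X$2$2"
    using det by simp
  then have "SL2C_inv X$1$1 = X$2$2"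
    using det by (metis mult_cancel_left mult_zero_left zero_neq_one)
  then have "1 \<le> cmod (X$2$2)" "1 \<le> cmod (X$1$1)"
    using contraction_not_in_stabilizer[OF G(1,2) p hi \<sigma>, unfolded inv]
      contraction_not_in_stabilizer[OF G(1,2) p h \<sigma>, folded X_def] by simp_all
  moreover have "cmod (X$1$1) * cmod (X$2$2) = 1"
    using det by (metis norm_mult norm_one)
  ultimately have d1: "cmod (X$2$2) = 1"
    using mult_right_mono[of 1 "cmod (X$1$1)" "cmod (X$2$2)"] by simp
  have "SL2C_inv \<sigma> ** (h ** g) = X ** (SL2C_inv \<sigma> ** g)"
    using \<sigma> by (simp add: X_def matrix_mul_assoc)
  then have "snd (hyp_act (SL2C_inv \<sigma> ** (h ** g)) \<omega>) = snd (hyp_act X (hyp_act (SL2C_inv \<sigma> ** g) \<omega>))"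
    using X \<sigma> g \<omega> by (simp add: height_mult)
  also have "\<dots> = snd (hyp_act (SL2C_inv \<sigma> ** g) \<omega>)"
    by (simp add: hyp_act_def[of X] Let_def c0 d1 split: prod.split)
  finally show ?thesis .
qed

lemma cusp_moebius:
  assumes G: "subgroup G SL2C" and "cusp G \<zeta>" "x \<in> G"
  shows "cusp G (moebius x \<zeta>)"
proof -
  note G_simps = subgroup_SL2C[OF G]
  obtain p where p: "p \<in> G" "parabolic p" "moebius p \<zeta> = \<zeta>"
    using assms(2) by (auto simp: cusp_def)
  obtain \<sigma> where \<sigma>: "\<sigma> \<in> carrier SL2C" "moebius \<sigma> None = \<zeta>"
    using exists_scaling .
  obtain e t where e: "e\<^sup>2 = 1" "t \<noteq> 0" and pe: "p = \<sigma> ** shear e t ** SL2C_inv \<sigma>"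
    using parabolic_eq_shear[OF p(2,3) \<sigma>] .
  have c: "p \<in> carrier SL2C" "x \<in> carrier SL2C"
    using p(1) assms(3) G_simps by blast+
  have "parabolic ((x ** \<sigma>) ** shear e t ** SL2C_inv (x ** \<sigma>))"
    using \<sigma> c e by (intro parabolic_shear) auto
  also have "(x ** \<sigma>) ** shear e t ** SL2C_inv (x ** \<sigma>) = x ** p ** SL2C_inv x"
    using \<sigma> c by (simp add: pe SL2C_inv_mult matrix_mul_assoc)
  finally show ?thesis
    using assms(3) p c by (auto simp: cusp_def moebius_mult G_simps intro!: bexI[of _ "x ** p ** SL2C_inv x"])
qed

lemma right_cosets_eq: "right_cosets K G = (\<lambda>g. (\<lambda>k. k ** g) ` K) ` G"
  by (auto simp: RCOSETS_def r_coset_def mult_SL2C)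

text \<open>Some power of a parabolic element lies in the subgroup of finite index, and a nontrivial power
  of a parabolic element is parabolic with the same fixed point.\<close>

lemma cusp_finite_index:
  assumes G: "subgroup G SL2C" and G': "subgroup G' SL2C" and fin: "finite (right_cosets G G')"
    and "cusp G' \<zeta>"
  shows "cusp G \<zeta>"
proof -
  obtain p where p: "p \<in> G'" "parabolic p" "moebius p \<zeta> = \<zeta>"
    using assms(4) by (auto simp: cusp_def)
  obtain \<sigma> where \<sigma>: "\<sigma> \<in> carrier SL2C" "moebius \<sigma> None = \<zeta>"
    using exists_scaling .
  obtain e t where e: "e\<^sup>2 = 1" and t: "t \<noteq> 0" and pe: "p = \<sigma> ** shear e t ** SL2C_inv \<sigma>"
    using parabolic_eq_shear[OF p(2,3) \<sigma>] .
  define P where "P n = \<sigma> ** shear (e ^ n) (of_nat n * t) ** SL2C_inv \<sigma>" for n :: nat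
  have P_add: "P (m + n) = P m ** P n" for m n
    by (simp add: P_def conj_SL2C_mult[OF \<sigma>(1)] shear_mult power_add algebra_simps)
  have P_G': "P n \<in> G'" for n
  proof (induction n)
    case 0
    have "shear 1 0 = I2"
      by (rule cmat2_eqI) simp_all
    then show ?case
      using \<sigma> subgroup_SL2C[OF G'] by (simp add: P_def)
  next
    case (Suc n)
    have "P 1 = p"
      by (simp add: P_def pe)
    then show ?case
      using Suc p(1) P_add[of n 1] subgroup_SL2C(2)[OF G'] by simp
  qed
  \<comment> \<open>Two powers of \<open>p\<close> lie in the same coset, so their quotient lies in \<open>G\<close>.\<close>
  have "range (\<lambda>n. (\<lambda>k. k ** P n) ` G) \<subseteq> right_cosets G G'"
    using P_G' by (auto simp: right_cosets_eq)
  then have "\<not> inj (\<lambda>n. (\<lambda>k. k ** P n) ` G)"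
    using fin finite_subset range_inj_infinite by blast
  then obtain i j where "i \<noteq> j" "(\<lambda>k. k ** P i) ` G = (\<lambda>k. k ** P j) ` G"
    by (auto simp: inj_def)
  then obtain i j where "i < j" and eq: "(\<lambda>k. k ** P i) ` G = (\<lambda>k. k ** P j) ` G"
    by (metis linorder_neqE_nat)
  define n where "n = j - i"
  have n: "0 < n" "j = n + i"
    using \<open>i < j\<close> by (simp_all add: n_def)
  have "P j \<in> (\<lambda>k. k ** P j) ` G"
    using subgroup_SL2C(1)[OF G] by (force intro: image_eqI[of _ _ I2])
  then obtain k where k: "k \<in> G" "P j = k ** P i"
    unfolding eq[symmetric] by blast
  have "P i \<in> carrier SL2C"
    using P_G' subgroup_SL2C(4)[OF G'] by blast
  then have "P n = k"
    using k(2) unfolding n(2) P_add by (metis SL2C_inverse(3))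
  then have "P n \<in> G"
    using k(1) by simp
  moreover have "(e ^ n)\<^sup>2 = 1"
    using e by (metis power_mult mult.commute power_one)
  then have "parabolic (P n)" and "shear (e ^ n) (of_nat n * t) \<in> carrier SL2C"
    using \<sigma> n(1) t by (simp_all add: P_def parabolic_shear shear_SL2C)
  moreover have "moebius (P n) \<zeta> = \<zeta>"
    using \<sigma> \<open>shear (e ^ n) _ \<in> _\<close> moebius_None_eq_None[of "shear (e ^ n) (of_nat n * t)"]
    by (simp add: P_def moebius_mult moebius_eq_iff[OF \<sigma>(1), symmetric])
       (metis moebius_inv(2))
  ultimately show ?thesis
    by (auto simp: cusp_def)
qed

section \<open>Inner products and orthonormal lists\<close>

text \<open>These are the properties that the induced space inherits pointwise from the given space, so the
  lemmas below apply to both.\<close>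

locale ip_space =
  fixes H :: "'v::ab_group_add hermitian"
  assumes vector_space: "vector_space (smul H)"
    and subspace: "module.subspace (smul H) (vecs H)"
    and ip_add: "u \<in> vecs H \<Longrightarrow> v \<in> vecs H \<Longrightarrow> w \<in> vecs H \<Longrightarrow> ip H (u + v) w = ip H u w + ip H v w"
    and ip_smul: "u \<in> vecs H \<Longrightarrow> w \<in> vecs H \<Longrightarrow> ip H (smul H c u) w = c * ip H u w"
begin

sublocale V: vector_space "smul H"
  by (rule vector_space)

lemma vecs_0 [simp]: "0 \<in> vecs H"
  and vecs_add [simp]: "u \<in> vecs H \<Longrightarrow> v \<in> vecs H \<Longrightarrow> u + v \<in> vecs H"
  and vecs_smul [simp]: "u \<in> vecs H \<Longrightarrow> smul H c u \<in> vecs H"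
  using V.subspace_0[OF subspace] V.subspace_add[OF subspace] V.subspace_scale[OF subspace] by auto

lemma vecs_sum: "(\<And>a. a \<in> A \<Longrightarrow> f a \<in> vecs H) \<Longrightarrow> sum f A \<in> vecs H"
  by (rule V.subspace_sum[OF subspace])

lemma ip_0 [simp]: "w \<in> vecs H \<Longrightarrow> ip H 0 w = 0"
  using ip_smul[of 0 w 0] by simp

lemma ip_sum:
  assumes "\<And>a. a \<in> A \<Longrightarrow> f a \<in> vecs H" "w \<in> vecs H"
  shows "ip H (sum f A) w = (\<Sum>a\<in>A. ip H (f a) w)"
  using assms
proof (induction A rule: infinite_finite_induct)
  case (insert x A)
  then show ?case
    by (simp add: ip_add vecs_sum)
qed auto

lemma ip_linear_combination:
  assumes "\<And>a. a \<in> A \<Longrightarrow> f a \<in> vecs H" "w \<in> vecs H"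
  shows "ip H (\<Sum>a\<in>A. smul H (c a) (f a)) w = (\<Sum>a\<in>A. c a * ip H (f a) w)"
  using assms by (subst ip_sum) (auto intro!: sum.cong simp: ip_smul)

lemma orthonormal_basis_mem:
  assumes "orthonormal_basis H W B" "l < length B"
  shows "B ! l \<in> W"
  using assms V.span_base[of "B ! l" "set B"] by (auto simp: orthonormal_basis_def)

text \<open>The vectors that satisfy the expansion form a subspace, which contains the list.\<close>

lemma orthonormal_expansion:
  assumes B: "orthonormal_basis H W B" and W: "W \<subseteq> vecs H" and v: "v \<in> W"
  shows "v = (\<Sum>l<length B. smul H (ip H v (B ! l)) (B ! l))"
proof -
  have mem: "B ! l \<in> vecs H" if "l < length B" for l
    using orthonormal_basis_mem[OF B that] W by blast
  define S where "S = {v \<in> vecs H. v = (\<Sum>l<length B. smul H (ip H v (B ! l)) (B ! l))}"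
  have "V.subspace S"
  proof (rule V.subspaceI)
    show "0 \<in> S"
      by (simp add: S_def mem)
    show "x + y \<in> S" if "x \<in> S" "y \<in> S" for x y
    proof -
      have "(\<Sum>l<length B. smul H (ip H (x + y) (B ! l)) (B ! l)) =
            (\<Sum>l<length B. smul H (ip H x (B ! l)) (B ! l)) + (\<Sum>l<length B. smul H (ip H y (B ! l)) (B ! l))"
        unfolding sum.distrib[symmetric] using that
        by (intro sum.cong) (auto simp: ip_add mem S_def V.scale_left_distrib)
      then show ?thesis
        using that by (simp add: S_def)
    qed
    show "smul H c x \<in> S" if "x \<in> S" for c x
    proof -
      have "(\<Sum>l<length B. smul H (ip H (smul H c x) (B ! l)) (B ! l)) =
            smul H c (\<Sum>l<length B. smul H (ip H x (B ! l)) (B ! l))"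
        unfolding V.scale_sum_right using that
        by (intro sum.cong) (auto simp: ip_smul mem S_def)
      then show ?thesis
        using that by (simp add: S_def)
    qed
  qed
  moreover have "set B \<subseteq> S"
  proof
    fix b assume "b \<in> set B"
    then obtain m where m: "m < length B" "b = B ! m"
      by (auto simp: in_set_conv_nth)
    have "(\<Sum>l<length B. smul H (ip H b (B ! l)) (B ! l)) = (\<Sum>l<length B. if l = m then B ! l else 0)"
      using B m by (intro sum.cong) (auto simp: orthonormal_basis_def)
    then show "b \<in> S"
      using m mem by (simp add: S_def)
  qed
  ultimately have "V.span (set B) \<subseteq> S"
    by (intro V.span_minimal)
  moreover have "v \<in> V.span (set B)"
    using B v by (simp add: orthonormal_basis_def)
  ultimately have "v \<in> S"
    by blast
  then show ?thesis
    unfolding S_def by blast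
qed

end

lemma ip_space_hermitian:
  assumes "hermitian_space H"
  shows "ip_space H"
proof -
  have "vector_space (smul H) \<and> module.subspace (smul H) (vecs H) \<and>
     (\<forall>u\<in>vecs H. \<forall>v\<in>vecs H. \<forall>w\<in>vecs H. ip H (u + v) w = ip H u w + ip H v w) \<and>
     (\<forall>c. \<forall>u\<in>vecs H. \<forall>w\<in>vecs H. ip H (smul H c u) w = c * ip H u w)"
    using assms unfolding hermitian_space_def by (elim conjE, intro conjI)
  then show ?thesis
    by (auto intro!: ip_space.intro)
qed

section \<open>Eisenstein series as sums over the orbit of a cusp\<close>

definition orbit :: "cmat2 set \<Rightarrow> complex option \<Rightarrow> complex option set" where
  "orbit G \<zeta> = (\<lambda>g. moebius g \<zeta>) ` G"

lemma coset_eq_of_mem: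
  assumes K: "subgroup K SL2C" and x: "x \<in> (\<lambda>k. k ** g) ` K"
  shows "(\<lambda>k. k ** x) ` K = (\<lambda>k. k ** g) ` K"
proof -
  obtain h where h: "h \<in> K" "x = h ** g"
    using x by auto
  have 1: "k ** x = (k ** h) ** g" "k ** g = (k ** SL2C_inv h) ** x" for k
    using h subgroup_SL2C(4)[OF K] by (simp_all add: matrix_mul_assoc)
  have 2: "k ** h \<in> K" "k ** SL2C_inv h \<in> K" if "k \<in> K" for k
    using h that subgroup_SL2C(2,3)[OF K] by simp_all
  show ?thesis
  proof (intro equalityI subsetI)
    fix y assume "y \<in> (\<lambda>k. k ** x) ` K"
    then show "y \<in> (\<lambda>k. k ** g) ` K"
      using 1(1) 2(1) by fast
  next
    fix y assume "y \<in> (\<lambda>k. k ** g) ` K"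
    then show "y \<in> (\<lambda>k. k ** x) ` K"
      using 1(2) 2(2) by fast
  qed
qed

lemma coset_some:
  assumes K: "subgroup K SL2C" and G: "subgroup G SL2C" and "K \<subseteq> G" and C: "C \<in> right_cosets K G"
  shows "(SOME x. x \<in> C) \<in> G" "(\<lambda>k. k ** (SOME x. x \<in> C)) ` K = C" "(SOME x. x \<in> C) \<in> C"
proof -
  obtain g where g: "g \<in> G" "C = (\<lambda>k. k ** g) ` K"
    using C by (auto simp: right_cosets_eq)
  show some: "(SOME x. x \<in> C) \<in> C"
    using subgroup_SL2C(1)[OF K] g by (auto simp: some_in_eq)
  then obtain k where "k \<in> K" "(SOME x. x \<in> C) = k ** g"
    unfolding g(2) by blast
  then show "(SOME x. x \<in> C) \<in> G"
    using g(1) \<open>K \<subseteq> G\<close> subgroup_SL2C(2)[OF G] by auto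
  show "(\<lambda>k. k ** (SOME x. x \<in> C)) ` K = C"
    using coset_eq_of_mem[OF K, of "SOME x. x \<in> C" g] some g(2) by simp
qed

lemma subgroup_cusp_stabilizer:
  assumes "subgroup G SL2C"
  shows "subgroup (cusp_stabilizer G \<zeta>) SL2C"
proof -
  note G = subgroup_SL2C[OF assms]
  show ?thesis
  proof (rule SL2C.subgroupI)
    show "cusp_stabilizer G \<zeta> \<subseteq> carrier SL2C"
      using G by (auto simp: cusp_stabilizer_def)
    show "cusp_stabilizer G \<zeta> \<noteq> {}"
      using G(1) by (auto simp: cusp_stabilizer_def intro!: exI[of _ I2])
    show "SL2C_inv a \<in> cusp_stabilizer G \<zeta>" if "a \<in> cusp_stabilizer G \<zeta>" for a
      using that G(3,4) by (auto simp: cusp_stabilizer_def) (metis moebius_inv(2))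
    show "a \<otimes>\<^bsub>SL2C\<^esub> b \<in> cusp_stabilizer G \<zeta>" if "a \<in> cusp_stabilizer G \<zeta>" "b \<in> cusp_stabilizer G \<zeta>" for a b
      using that G(2,4) by (auto simp: cusp_stabilizer_def mult_SL2C moebius_mult)
  qed
qed

text \<open>The cosets of the stabilizer of \<open>\<zeta>\<close> correspond to the points of the orbit of \<open>\<zeta>\<close>, so a summand that
  is well defined on cosets can be read as a function \<open>t\<close> on the orbit.\<close>

lemma has_sum_cosets_iff_orbit:
  assumes G: "subgroup G SL2C" and t: "\<And>g. g \<in> G \<Longrightarrow> \<Phi> g = t (moebius (SL2C_inv g) \<zeta>)"
  shows "((\<lambda>C. \<Phi> (SOME g. g \<in> C)) has_sum L) (right_cosets (cusp_stabilizer G \<zeta>) G)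
     \<longleftrightarrow> (t has_sum L) (orbit G \<zeta>)"
proof -
  define K where "K = cusp_stabilizer G \<zeta>"
  note G_simps = subgroup_SL2C[OF G]
  have K: "subgroup K SL2C"
    unfolding K_def by (rule subgroup_cusp_stabilizer[OF G])
  have KG: "K \<subseteq> G"
    by (auto simp: K_def cusp_stabilizer_def)
  define r :: "cmat2 set \<Rightarrow> cmat2" where "r C = (SOME g. g \<in> C)" for C
  have r: "r C \<in> G \<and> C = (\<lambda>k. k ** r C) ` K" if "C \<in> right_cosets K G" for C
    using coset_some[OF K G KG that] by (simp add: r_def)
  have "bij_betw (\<lambda>C. moebius (SL2C_inv (r C)) \<zeta>) (right_cosets K G) (orbit G \<zeta>)"
    unfolding bij_betw_def
  proof (rule conjI[OF inj_onI equalityI[OF subsetI subsetI]])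
    fix C D assume C: "C \<in> right_cosets K G" and D: "D \<in> right_cosets K G"
      and eq: "moebius (SL2C_inv (r C)) \<zeta> = moebius (SL2C_inv (r D)) \<zeta>"
    have c: "r C \<in> carrier SL2C" "r D \<in> carrier SL2C" "r C \<in> G" "r D \<in> G"
      using r[OF C] r[OF D] by (blast intro: G_simps(4))+
    have "r C = (r C ** SL2C_inv (r D)) ** r D"
      using c by simp
    moreover have "r C ** SL2C_inv (r D) \<in> K"
      using c eq[symmetric] by (simp add: K_def cusp_stabilizer_def G_simps moebius_mult)
    ultimately have "r C \<in> (\<lambda>k. k ** r D) ` K"
      by (rule image_eqI)
    then have "(\<lambda>k. k ** r C) ` K = (\<lambda>k. k ** r D) ` K"
      by (rule coset_eq_of_mem[OF K])
    then show "C = D"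
      using r[OF C] r[OF D] by metis
  next
    fix \<xi> assume "\<xi> \<in> (\<lambda>C. moebius (SL2C_inv (r C)) \<zeta>) ` right_cosets K G"
    then show "\<xi> \<in> orbit G \<zeta>"
      using r G_simps(3) by (auto simp: orbit_def)
  next
    fix \<xi> assume "\<xi> \<in> orbit G \<zeta>"
    then obtain g where g: "g \<in> G" "\<xi> = moebius g \<zeta>"
      by (auto simp: orbit_def)
    define C where "C = (\<lambda>k. k ** SL2C_inv g) ` K"
    have C: "C \<in> right_cosets K G"
      using g G_simps by (auto simp: C_def right_cosets_eq)
    have "r C \<in> C"
      unfolding r_def by (rule coset_some(3)[OF K G KG C])
    then obtain k where k: "k \<in> K" "r C = k ** SL2C_inv g"
      by (auto simp: C_def)
    have c: "g \<in> carrier SL2C" "k \<in> carrier SL2C" "moebius k \<zeta> = \<zeta>"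
      using g k G_simps by (auto simp: K_def cusp_stabilizer_def)
    then have "moebius (SL2C_inv (r C)) \<zeta> = moebius g (moebius (SL2C_inv k) \<zeta>)"
      by (simp add: k SL2C_inv_mult moebius_mult)
    also have "moebius (SL2C_inv k) \<zeta> = \<zeta>"
      using c by (metis moebius_inv(2))
    finally show "\<xi> \<in> (\<lambda>C. moebius (SL2C_inv (r C)) \<zeta>) ` right_cosets K G"
      using C g by force
  qed
  then have "((\<lambda>C. t (moebius (SL2C_inv (r C)) \<zeta>)) has_sum L) (right_cosets K G) \<longleftrightarrow> (t has_sum L) (orbit G \<zeta>)"
    by (rule has_sum_reindex_bij_betw)
  moreover have "((\<lambda>C. t (moebius (SL2C_inv (r C)) \<zeta>)) has_sum L) (right_cosets K G)
      \<longleftrightarrow> ((\<lambda>C. \<Phi> (r C)) has_sum L) (right_cosets K G)"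
    using r t by (intro has_sum_cong) auto
  ultimately show ?thesis
    by (simp add: K_def r_def)
qed

section \<open>Singular vectors of the induced representation\<close>

text \<open>The cusp \<open>j\<close> of \<open>\<Gamma>\<close> lies over the cusp \<open>\<kappa> j\<close> of \<open>\<Gamma>'\<close>, and \<open>\<tau> j\<close> moves the latter to the former. The
  assumptions on \<open>\<kappa>\<close> and \<open>\<tau>\<close> spell out the compatibility of the scaling matrices.\<close>

locale induction_setting = ip_space H
  for H :: "'v::ab_group_add hermitian" +
  fixes \<Gamma> \<Gamma>' :: "cmat2 set"
    and \<eta> :: "cmat2 \<Rightarrow> 'v \<Rightarrow> 'v"
    and as as' :: "complex option list"
    and \<sigma>s \<sigma>s' :: "cmat2 list"
    and \<kappa> :: "nat \<Rightarrow> nat"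
    and \<tau> :: "nat \<Rightarrow> cmat2"
  assumes \<Gamma>: "subgroup \<Gamma> SL2C" and \<Gamma>': "subgroup \<Gamma>' SL2C" and \<Gamma>_sub: "\<Gamma> \<subseteq> \<Gamma>'"
    and discrete': "discrete \<Gamma>'"
    and finite_index: "finite (right_cosets \<Gamma> \<Gamma>')"
    and ip_cnj: "u \<in> vecs H \<Longrightarrow> w \<in> vecs H \<Longrightarrow> ip H w u = cnj (ip H u w)"
    and unitary: "unitary_rep \<Gamma> H \<eta>"
    and cusps: "complete_cusps \<Gamma> as" and cusps': "complete_cusps \<Gamma>' as'"
    and scaling': "scaling_matrices as' \<sigma>s'"
    and \<kappa>: "j < length as \<Longrightarrow> \<kappa> j < length as'"
    and \<tau>: "j < length as \<Longrightarrow> \<tau> j \<in> \<Gamma>'"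
    and \<tau>_cusp: "j < length as \<Longrightarrow> moebius (\<tau> j) (as' ! \<kappa> j) = as ! j"
    and \<sigma>_compatible: "j < length as \<Longrightarrow> \<sigma>s ! j = \<tau> j ** \<sigma>s' ! \<kappa> j"
begin

abbreviation "H' \<equiv> induced_space \<Gamma>' \<Gamma> H \<eta>"
abbreviation "sing j \<equiv> singular_space \<Gamma> H \<eta> (as ! j)"
abbreviation "sing' k \<equiv> singular_space \<Gamma>' H' induced_rep (as' ! k)"
abbreviation "rep C \<equiv> (SOME x. x \<in> C)"
abbreviation "coset x \<equiv> (\<lambda>\<gamma>. \<gamma> ** x) ` \<Gamma>"

lemmas \<Gamma>_simps = subgroup_SL2C[OF \<Gamma>] and \<Gamma>'_simps = subgroup_SL2C[OF \<Gamma>']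

lemma \<Gamma>_in_\<Gamma>': "\<gamma> \<in> \<Gamma> \<Longrightarrow> \<gamma> \<in> \<Gamma>'"
  using \<Gamma>_sub by blast

lemma \<eta>_vecs [simp]: "\<gamma> \<in> \<Gamma> \<Longrightarrow> v \<in> vecs H \<Longrightarrow> \<eta> \<gamma> v \<in> vecs H"
  and \<eta>_add: "\<gamma> \<in> \<Gamma> \<Longrightarrow> u \<in> vecs H \<Longrightarrow> v \<in> vecs H \<Longrightarrow> \<eta> \<gamma> (u + v) = \<eta> \<gamma> u + \<eta> \<gamma> v"
  and \<eta>_smul: "\<gamma> \<in> \<Gamma> \<Longrightarrow> v \<in> vecs H \<Longrightarrow> \<eta> \<gamma> (smul H c v) = smul H c (\<eta> \<gamma> v)"
  and \<eta>_ip: "\<gamma> \<in> \<Gamma> \<Longrightarrow> u \<in> vecs H \<Longrightarrow> v \<in> vecs H \<Longrightarrow> ip H (\<eta> \<gamma> u) (\<eta> \<gamma> v) = ip H u v"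
  and \<eta>_I2: "v \<in> vecs H \<Longrightarrow> \<eta> I2 v = v"
  and \<eta>_mult: "\<gamma> \<in> \<Gamma> \<Longrightarrow> \<delta> \<in> \<Gamma> \<Longrightarrow> v \<in> vecs H \<Longrightarrow> \<eta> (\<gamma> ** \<delta>) v = \<eta> \<gamma> (\<eta> \<delta> v)"
  using unitary unfolding unitary_rep_def by auto

lemma \<eta>_0 [simp]: "\<gamma> \<in> \<Gamma> \<Longrightarrow> \<eta> \<gamma> 0 = 0"
  using \<eta>_smul[of \<gamma> 0 0] by simp

lemma ip_0_right [simp]: "u \<in> vecs H \<Longrightarrow> ip H u 0 = 0"
  using ip_cnj[of 0 u] by simp

lemma \<eta>_linear_combination:
  assumes "\<gamma> \<in> \<Gamma>" "\<And>a. a \<in> A \<Longrightarrow> f a \<in> vecs H"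
  shows "\<eta> \<gamma> (\<Sum>a\<in>A. smul H (c a) (f a)) = (\<Sum>a\<in>A. smul H (c a) (\<eta> \<gamma> (f a)))"
  using assms(2)
proof (induction A rule: infinite_finite_induct)
  case (insert x A)
  then have "(\<Sum>a\<in>A. smul H (c a) (f a)) \<in> vecs H"
    by (intro vecs_sum) auto
  then show ?case
    using insert assms(1) by (simp add: \<eta>_add \<eta>_smul)
qed (use assms(1) in auto)

lemma rep_coset:
  assumes "C \<in> right_cosets \<Gamma> \<Gamma>'"
  shows "rep C \<in> \<Gamma>'" "coset (rep C) = C"
  using coset_some[OF \<Gamma> \<Gamma>' \<Gamma>_sub assms] by simp_all

lemma coset_in: "x \<in> \<Gamma>' \<Longrightarrow> coset x \<in> right_cosets \<Gamma> \<Gamma>'"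
  by (auto simp: right_cosets_eq)

lemma rep_quotient:
  assumes "x \<in> \<Gamma>'"
  shows "x ** SL2C_inv (rep (coset x)) \<in> \<Gamma>"
proof -
  have "x \<in> coset (rep (coset x))"
    unfolding rep_coset(2)[OF coset_in[OF assms]] using \<Gamma>_simps(1) by (force intro: image_eqI[of _ _ I2])
  then obtain \<gamma> where \<gamma>: "\<gamma> \<in> \<Gamma>" "x = \<gamma> ** rep (coset x)"
    by auto
  moreover have "rep (coset x) \<in> carrier SL2C"
    using rep_coset(1)[OF coset_in[OF assms]] \<Gamma>'_simps(4) by blast
  ultimately show ?thesis
    by (metis SL2C_inverse(3))
qed

lemma H'_vecs: "f \<in> vecs H' \<longleftrightarrow> (\<forall>x\<in>\<Gamma>'. f x \<in> vecs H) \<and> (\<forall>x. x \<notin> \<Gamma>' \<longrightarrow> f x = 0) \<and>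
    (\<forall>\<gamma>\<in>\<Gamma>. \<forall>x\<in>\<Gamma>'. f (\<gamma> ** x) = \<eta> \<gamma> (f x))"
  and H'_smul: "smul H' c f = (\<lambda>x. smul H c (f x))"
  and H'_ip: "ip H' f h = (\<Sum>C\<in>right_cosets \<Gamma> \<Gamma>'. ip H (f (rep C)) (h (rep C)))"
  by (simp_all add: induced_space_def)

lemma H'_vecsD:
  assumes "f \<in> vecs H'"
  shows "f x \<in> vecs H" "\<gamma> \<in> \<Gamma> \<Longrightarrow> x \<in> \<Gamma>' \<Longrightarrow> f (\<gamma> ** x) = \<eta> \<gamma> (f x)"
  using assms by (cases "x \<in> \<Gamma>'"; simp add: H'_vecs)+

sublocale H': ip_space H'
proof (rule ip_space.intro)
  show "vector_space (smul H')"
    by unfold_locales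
      (auto simp: H'_smul V.scale_right_distrib V.scale_left_distrib fun_eq_iff)
  then interpret V': vector_space "smul H'" .
  show "module.subspace (smul H') (vecs H')"
    by (rule V'.subspaceI) (auto simp: H'_vecs H'_smul \<eta>_add \<eta>_smul)
qed (auto simp: H'_ip H'_smul H'_vecsD ip_add ip_smul sum.distrib sum_distrib_left)

lemma H'_determined:
  assumes "f \<in> vecs H'" "x \<in> \<Gamma>'"
  shows "f x = \<eta> (x ** SL2C_inv (rep (coset x))) (f (rep (coset x)))"
proof -
  have r: "rep (coset x) \<in> \<Gamma>'"
    by (rule rep_coset(1)[OF coset_in[OF assms(2)]])
  have "f ((x ** SL2C_inv (rep (coset x))) ** rep (coset x)) = \<eta> (x ** SL2C_inv (rep (coset x))) (f (rep (coset x)))"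
    using assms(1) rep_quotient[OF assms(2)] r by (rule H'_vecsD(2))
  then show ?thesis
    using r \<Gamma>'_simps(4) by simp
qed

lemma H'_eqI:
  assumes "f \<in> vecs H'" "h \<in> vecs H'" "\<And>C. C \<in> right_cosets \<Gamma> \<Gamma>' \<Longrightarrow> f (rep C) = h (rep C)"
  shows "f = h"
proof
  fix x
  show "f x = h x"
  proof (cases "x \<in> \<Gamma>'")
    case True
    then show ?thesis
      using H'_determined[OF assms(1) True] H'_determined[OF assms(2) True] assms(3)[OF coset_in[OF True]]
      by simp
  next
    case False
    then show ?thesis
      using assms(1,2) by (simp add: H'_vecs)
  qed
qed

text \<open>Values prescribed on the coset representatives extend to a vector of the induced space; by
  \<open>H'_determined\<close> the extension is unique.\<close>

definition extend :: "(cmat2 \<Rightarrow> 'v) \<Rightarrow> cmat2 \<Rightarrow> 'v" where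
  "extend \<phi> x = (if x \<in> \<Gamma>' then \<eta> (x ** SL2C_inv (rep (coset x))) (\<phi> (rep (coset x))) else 0)"

lemma extend_rep:
  assumes "C \<in> right_cosets \<Gamma> \<Gamma>'" "\<phi> (rep C) \<in> vecs H"
  shows "extend \<phi> (rep C) = \<phi> (rep C)"
  using rep_coset[OF assms(1)] assms(2) \<Gamma>'_simps(4) by (simp add: extend_def \<eta>_I2)

lemma extend_vecs:
  assumes "\<And>x. x \<in> \<Gamma>' \<Longrightarrow> \<phi> x \<in> vecs H"
  shows "extend \<phi> \<in> vecs H'"
  unfolding H'_vecs
proof (intro conjI ballI allI impI)
  fix x assume x: "x \<in> \<Gamma>'"
  have r: "rep (coset x) \<in> \<Gamma>'"
    by (rule rep_coset(1)[OF coset_in[OF x]])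
  show "extend \<phi> x \<in> vecs H"
    using x r by (simp add: extend_def rep_quotient assms)
  fix \<gamma> assume \<gamma>: "\<gamma> \<in> \<Gamma>"
  have "coset (\<gamma> ** x) = coset x"
    using \<gamma> by (intro coset_eq_of_mem[OF \<Gamma>]) auto
  then show "extend \<phi> (\<gamma> ** x) = \<eta> \<gamma> (extend \<phi> x)"
    using x r \<gamma> rep_quotient[OF x]
    by (simp add: extend_def assms \<Gamma>'_simps \<Gamma>_in_\<Gamma>' flip: \<eta>_mult matrix_mul_assoc)
qed (simp add: extend_def)

lemma cusp_as:
  assumes "j < length as"
  shows "cusp \<Gamma> (as ! j)"
  using cusps assms by (simp add: complete_cusps_def)

lemma cusp_as':
  assumes "k < length as'"
  shows "cusp \<Gamma>' (as' ! k)"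
  using cusps' assms by (simp add: complete_cusps_def)

lemma cusp_class_unique:
  assumes "i < length as" "j < length as" "g \<in> \<Gamma>" "h \<in> \<Gamma>" "moebius g (as ! i) = moebius h (as ! j)"
  shows "i = j"
proof -
  have "cusp \<Gamma> (moebius g (as ! i))"
    by (rule cusp_moebius[OF \<Gamma> cusp_as assms(3)]) fact
  then have "\<exists>!j. j < length as \<and> (\<exists>x\<in>\<Gamma>. moebius x (as ! j) = moebius g (as ! i))"
    using cusps by (simp add: complete_cusps_def)
  then show ?thesis
    using assms by metis
qed

lemma cusp_class_unique':
  assumes "i < length as'" "j < length as'" "g \<in> \<Gamma>'" "h \<in> \<Gamma>'" "moebius g (as' ! i) = moebius h (as' ! j)"
  shows "i = j"
proof -
  have "cusp \<Gamma>' (moebius g (as' ! i))"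
    by (rule cusp_moebius[OF \<Gamma>' cusp_as' assms(3)]) fact
  then have "\<exists>!j. j < length as' \<and> (\<exists>x\<in>\<Gamma>'. moebius x (as' ! j) = moebius g (as' ! i))"
    using cusps' by (simp add: complete_cusps_def)
  then show ?thesis
    using assms by metis
qed

definition cusps_over :: "nat \<Rightarrow> nat set" where
  "cusps_over k = {j. j < length as \<and> \<kappa> j = k}"

lemma finite_cusps_over [simp]: "finite (cusps_over k)"
  by (simp add: cusps_over_def)

text \<open>Both groups have the same cusps, since the index is finite.\<close>

lemma exists_cusp_over:
  assumes k: "k < length as'" and x: "x \<in> \<Gamma>'"
  obtains j \<gamma> where "j \<in> cusps_over k" "\<gamma> \<in> \<Gamma>" "moebius \<gamma> (as ! j) = moebius x (as' ! k)"
proof -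
  have "cusp \<Gamma>' (moebius x (as' ! k))"
    by (rule cusp_moebius[OF \<Gamma>' cusp_as'[OF k] x])
  then have "cusp \<Gamma> (moebius x (as' ! k))"
    by (rule cusp_finite_index[OF \<Gamma> \<Gamma>' finite_index])
  then obtain j \<gamma> where j: "j < length as" and \<gamma>: "\<gamma> \<in> \<Gamma>" "moebius \<gamma> (as ! j) = moebius x (as' ! k)"
    using cusps unfolding complete_cusps_def by blast
  have c: "\<gamma> \<in> \<Gamma>'" "\<tau> j \<in> \<Gamma>'" "\<gamma> \<in> carrier SL2C" "\<tau> j \<in> carrier SL2C"
    using \<Gamma>_in_\<Gamma>'[OF \<gamma>(1)] \<tau>[OF j] \<Gamma>'_simps(4) by auto
  have "moebius (\<gamma> ** \<tau> j) (as' ! \<kappa> j) = moebius x (as' ! k)"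
    using c \<gamma>(2) by (simp add: moebius_mult \<tau>_cusp[OF j])
  then have "\<kappa> j = k"
    using cusp_class_unique'[OF \<kappa>[OF j] k, of "\<gamma> ** \<tau> j" x] c x \<Gamma>'_simps(2) by blast
  then show ?thesis
    using that[of j \<gamma>] j \<gamma> by (simp add: cusps_over_def)
qed

text \<open>A point \<open>x \<zeta>\<close> of the larger orbit is a cusp of \<open>\<Gamma>\<close>, so it is \<open>\<Gamma>\<close>-equivalent to a cusp of the list, which
  must lie over \<open>\<zeta>\<close>.\<close>

lemma orbit_decomposition:
  assumes "k < length as'"
  shows "orbit \<Gamma>' (as' ! k) = (\<Union>j\<in>cusps_over k. orbit \<Gamma> (as ! j))"
proof (intro equalityI subsetI)
  fix \<xi> assume "\<xi> \<in> orbit \<Gamma>' (as' ! k)"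
  then obtain x where x: "x \<in> \<Gamma>'" "\<xi> = moebius x (as' ! k)"
    by (auto simp: orbit_def)
  obtain j \<gamma> where "j \<in> cusps_over k" "\<gamma> \<in> \<Gamma>" "moebius \<gamma> (as ! j) = moebius x (as' ! k)"
    using exists_cusp_over[OF assms x(1)] .
  then show "\<xi> \<in> (\<Union>j\<in>cusps_over k. orbit \<Gamma> (as ! j))"
    using x(2) by (force simp: orbit_def)
next
  fix \<xi> assume "\<xi> \<in> (\<Union>j\<in>cusps_over k. orbit \<Gamma> (as ! j))"
  then obtain j \<gamma> where j: "j < length as" "\<kappa> j = k" and \<gamma>: "\<gamma> \<in> \<Gamma>" "\<xi> = moebius \<gamma> (as ! j)"
    by (auto simp: orbit_def cusps_over_def)
  have c: "\<gamma> \<in> \<Gamma>'" "\<tau> j \<in> \<Gamma>'" "\<gamma> \<in> carrier SL2C" "\<tau> j \<in> carrier SL2C"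
    using \<Gamma>_in_\<Gamma>'[OF \<gamma>(1)] \<tau>[OF j(1)] \<Gamma>'_simps(4) by auto
  have "\<xi> = moebius (\<gamma> ** \<tau> j) (as' ! k)"
    using c \<gamma>(2) \<tau>_cusp[OF j(1)] j(2) by (simp add: moebius_mult)
  then show "\<xi> \<in> orbit \<Gamma>' (as' ! k)"
    using c \<Gamma>'_simps(2) by (auto simp: orbit_def)
qed

lemma orbits_disjoint:
  assumes "i \<in> cusps_over k" "j \<in> cusps_over k" "i \<noteq> j"
  shows "orbit \<Gamma> (as ! i) \<inter> orbit \<Gamma> (as ! j) = {}"
  using assms cusp_class_unique by (auto simp: orbit_def cusps_over_def)

lemma singD:
  assumes "v \<in> sing j"
  shows "v \<in> vecs H" "\<gamma> \<in> \<Gamma> \<Longrightarrow> moebius \<gamma> (as ! j) = as ! j \<Longrightarrow> \<eta> \<gamma> v = v"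
  using assms by (auto simp: singular_space_def cusp_stabilizer_def)

lemma sing'D:
  assumes "f \<in> sing' k"
  shows "f \<in> vecs H'" "h \<in> \<Gamma>' \<Longrightarrow> moebius h (as' ! k) = as' ! k \<Longrightarrow> f (x ** h) = f x"
  using assms by (auto simp: singular_space_def cusp_stabilizer_def induced_rep_def fun_eq_iff)

text \<open>A singular vector \<open>f\<close> of the induced representation at a cusp \<open>\<zeta>\<close> is right invariant under the
  stabilizer of \<open>\<zeta>\<close>, hence a function of the boundary point \<open>x \<zeta>\<close>.\<close>

lemma sing'_cong:
  assumes f: "f \<in> sing' k" and x: "x \<in> \<Gamma>'" "y \<in> \<Gamma>'" "moebius x (as' ! k) = moebius y (as' ! k)"
  shows "f x = f y"
proof -
  have c: "x \<in> carrier SL2C" "y \<in> carrier SL2C"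
    using x \<Gamma>'_simps(4) by auto
  have "SL2C_inv y ** x \<in> \<Gamma>'"
    using x \<Gamma>'_simps by blast
  moreover have "moebius (SL2C_inv y ** x) (as' ! k) = as' ! k"
    using c x(3) by (simp add: moebius_mult)
  ultimately have "f (y ** (SL2C_inv y ** x)) = f y"
    by (rule sing'D(2)[OF f])
  then show ?thesis
    using c by (simp add: matrix_mul_assoc)
qed

text \<open>The value of a singular vector \<open>f\<close> at \<open>\<tau>\<^sub>j\<close> is singular at the cusp \<open>j\<close>.\<close>

lemma sing'_value:
  assumes f: "f \<in> sing' (\<kappa> j)" and j: "j < length as"
  shows "f (\<tau> j) \<in> sing j"
  unfolding singular_space_def cusp_stabilizer_def
proof safe
  show "f (\<tau> j) \<in> vecs H"
    using sing'D(1)[OF f] by (rule H'_vecsD)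
  fix \<gamma> assume \<gamma>: "\<gamma> \<in> \<Gamma>" "moebius \<gamma> (as ! j) = as ! j"
  have c: "\<gamma> \<in> \<Gamma>'" "\<tau> j \<in> \<Gamma>'" "\<gamma> \<in> carrier SL2C" "\<tau> j \<in> carrier SL2C"
    using \<Gamma>_in_\<Gamma>'[OF \<gamma>(1)] \<tau>[OF j(1)] \<Gamma>'_simps(4) by auto
  have "\<eta> \<gamma> (f (\<tau> j)) = f (\<gamma> ** \<tau> j)"
    using H'_vecsD(2)[OF sing'D(1)[OF f]] \<gamma>(1) c(2) by simp
  also have "\<dots> = f (\<tau> j)"
    using c \<gamma>(2) by (intro sing'_cong[OF f]) (simp_all add: \<Gamma>'_simps moebius_mult \<tau>_cusp[OF j])
  finally show "\<eta> \<gamma> (f (\<tau> j)) = f (\<tau> j)" .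
qed

text \<open>Conversely, a vector \<open>v\<close> that is singular at the cusp \<open>j\<close> extends to the singular vector supported
  on the double coset of \<open>\<tau>\<^sub>j\<close>, that is, on those \<open>x\<close> which map the cusp below to a point of the
  \<open>\<Gamma>\<close>-orbit of the cusp \<open>j\<close>.\<close>

definition lift :: "nat \<Rightarrow> 'v \<Rightarrow> cmat2 \<Rightarrow> 'v" where
  "lift j v x = (if x \<in> \<Gamma>' \<and> moebius x (as' ! \<kappa> j) \<in> orbit \<Gamma> (as ! j)
     then \<eta> (SOME \<gamma>. \<gamma> \<in> \<Gamma> \<and> moebius \<gamma> (as ! j) = moebius x (as' ! \<kappa> j)) v else 0)"

lemma lift_eq:
  assumes v: "v \<in> sing j" and x: "x \<in> \<Gamma>'" and \<gamma>: "\<gamma> \<in> \<Gamma>" "moebius \<gamma> (as ! j) = moebius x (as' ! \<kappa> j)"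
  shows "lift j v x = \<eta> \<gamma> v"
proof -
  define \<delta> where "\<delta> = (SOME \<gamma>. \<gamma> \<in> \<Gamma> \<and> moebius \<gamma> (as ! j) = moebius x (as' ! \<kappa> j))"
  have \<delta>: "\<delta> \<in> \<Gamma> \<and> moebius \<delta> (as ! j) = moebius x (as' ! \<kappa> j)"
    unfolding \<delta>_def by (rule someI[of _ \<gamma>]) (use \<gamma> in simp)
  have c: "\<gamma> \<in> carrier SL2C" "\<delta> \<in> carrier SL2C"
    using \<gamma> \<delta> \<Gamma>_simps(4) by auto
  have "\<eta> \<delta> v = \<eta> (\<gamma> ** (SL2C_inv \<gamma> ** \<delta>)) v"
    using c by (simp add: matrix_mul_assoc)
  also have "\<dots> = \<eta> \<gamma> (\<eta> (SL2C_inv \<gamma> ** \<delta>) v)"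
    using \<gamma> \<delta> singD(1)[OF v] by (intro \<eta>_mult) (simp_all add: \<Gamma>_simps)
  also have "\<eta> (SL2C_inv \<gamma> ** \<delta>) v = v"
    using \<gamma> \<delta> c by (intro singD(2)[OF v]) (simp_all add: \<Gamma>_simps moebius_mult flip: \<gamma>(2))
  finally show ?thesis
    using x \<gamma> by (auto simp: lift_def \<delta>_def orbit_def image_iff)
qed

lemma lift_eq_0: "x \<notin> \<Gamma>' \<or> moebius x (as' ! \<kappa> j) \<notin> orbit \<Gamma> (as ! j) \<Longrightarrow> lift j v x = 0"
  by (auto simp: lift_def)

lemma lift_sing':
  assumes v: "v \<in> sing j"
  shows "lift j v \<in> sing' (\<kappa> j)"
proof -
  have "lift j v \<in> vecs H'"
    unfolding H'_vecs
  proof (intro conjI ballI allI impI)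
    fix x assume x: "x \<in> \<Gamma>'"
    show "lift j v x \<in> vecs H"
    proof (cases "moebius x (as' ! \<kappa> j) \<in> orbit \<Gamma> (as ! j)")
      case True
      then obtain \<gamma> where "\<gamma> \<in> \<Gamma>" "moebius \<gamma> (as ! j) = moebius x (as' ! \<kappa> j)"
        by (force simp: orbit_def)
      then show ?thesis
        using lift_eq[OF v x] singD(1)[OF v] by simp
    qed (simp add: lift_eq_0)
    fix \<delta> assume \<delta>: "\<delta> \<in> \<Gamma>"
    have c: "x \<in> carrier SL2C" "\<delta> \<in> carrier SL2C" "\<delta> ** x \<in> \<Gamma>'"
      using x \<delta> \<Gamma>'_simps(2,4) \<Gamma>_in_\<Gamma>' by auto
    show "lift j v (\<delta> ** x) = \<eta> \<delta> (lift j v x)"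
    proof (cases "moebius x (as' ! \<kappa> j) \<in> orbit \<Gamma> (as ! j)")
      case True
      then obtain \<gamma> where \<gamma>: "\<gamma> \<in> \<Gamma>" "moebius \<gamma> (as ! j) = moebius x (as' ! \<kappa> j)"
        by (force simp: orbit_def)
      have "lift j v (\<delta> ** x) = \<eta> (\<delta> ** \<gamma>) v"
        using \<gamma> \<delta> c \<Gamma>_simps by (intro lift_eq[OF v]) (auto simp: moebius_mult)
      then show ?thesis
        using lift_eq[OF v x \<gamma>] \<gamma> \<delta> singD(1)[OF v] by (simp add: \<eta>_mult)
    next
      case False
      have "moebius (\<delta> ** x) (as' ! \<kappa> j) \<notin> orbit \<Gamma> (as ! j)"
      proof
        assume "moebius (\<delta> ** x) (as' ! \<kappa> j) \<in> orbit \<Gamma> (as ! j)"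
        then obtain \<gamma> where \<gamma>: "\<gamma> \<in> \<Gamma>" "moebius \<delta> (moebius x (as' ! \<kappa> j)) = moebius \<gamma> (as ! j)"
          using c by (auto simp: orbit_def moebius_mult)
        then have "moebius x (as' ! \<kappa> j) = moebius (SL2C_inv \<delta> ** \<gamma>) (as ! j)"
          using c \<Gamma>_simps(4) by (simp add: moebius_mult) (metis moebius_inv(2))
        then show False
          using False \<gamma>(1) \<delta> \<Gamma>_simps by (auto simp: orbit_def)
      qed
      then show ?thesis
        using False \<delta> by (simp add: lift_eq_0)
    qed
  qed (simp add: lift_eq_0)
  moreover have "induced_rep h (lift j v) = lift j v" if h: "h \<in> \<Gamma>'" "moebius h (as' ! \<kappa> j) = as' ! \<kappa> j" for h
  proof
    fix x
    have hc: "h \<in> carrier SL2C"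
      using h \<Gamma>'_simps(4) by blast
    have "x \<in> \<Gamma>'" if "x ** h \<in> \<Gamma>'"
      using \<Gamma>'_simps(2)[OF that \<Gamma>'_simps(3)[OF h(1)]] hc by simp
    then have "x ** h \<in> \<Gamma>' \<longleftrightarrow> x \<in> \<Gamma>'"
      using \<Gamma>'_simps(2) h(1) by blast
    moreover have "moebius (x ** h) (as' ! \<kappa> j) = moebius x (as' ! \<kappa> j)" if "x \<in> \<Gamma>'"
      using that \<Gamma>'_simps(4) hc h(2) by (simp add: moebius_mult)
    ultimately show "induced_rep h (lift j v) x = lift j v x"
      by (cases "x \<in> \<Gamma>'") (simp_all add: induced_rep_def lift_def)
  qed
  ultimately show ?thesis
    by (auto simp: singular_space_def cusp_stabilizer_def)
qed

lemma lift_value: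
  assumes v: "v \<in> sing j" and j: "j < length as" and i: "i < length as" "\<kappa> i = \<kappa> j"
  shows "lift j v (\<tau> i) = (if i = j then v else 0)"
proof -
  have \<tau>i: "moebius (\<tau> i) (as' ! \<kappa> j) = as ! i"
    using \<tau>_cusp[OF i(1)] i(2) by simp
  show ?thesis
  proof (cases "i = j")
    case True
    then have "lift j v (\<tau> i) = \<eta> I2 v"
      using \<tau>i \<tau>[OF i(1)] \<Gamma>_simps(1) by (intro lift_eq[OF v]) simp_all
    then show ?thesis
      using True \<eta>_I2 singD(1)[OF v] by simp
  next
    case False
    have "as ! i \<notin> orbit \<Gamma> (as ! j)"
    proof
      assume "as ! i \<in> orbit \<Gamma> (as ! j)"
      then obtain \<gamma> where "\<gamma> \<in> \<Gamma>" "moebius I2 (as ! i) = moebius \<gamma> (as ! j)"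
        by (auto simp: orbit_def)
      then show False
        using cusp_class_unique[OF i(1) j \<Gamma>_simps(1)] False by blast
    qed
    then show ?thesis
      using False \<tau>i by (simp add: lift_eq_0)
  qed
qed

lemma sum_fun_apply: "(\<Sum>a\<in>A. F a) x = (\<Sum>a\<in>A. F a x)" for F :: "'b \<Rightarrow> cmat2 \<Rightarrow> 'v"
  by (induction A rule: infinite_finite_induct) auto

text \<open>The two constructions invert each other: the singular space at a cusp of the larger group is
  the direct sum of the singular spaces at the cusps above it.\<close>

lemma sing'_decomposition:
  assumes k: "k < length as'" and f: "f \<in> sing' k"
  shows "f = (\<Sum>j\<in>cusps_over k. lift j (f (\<tau> j)))"
proof
  fix x
  show "f x = (\<Sum>j\<in>cusps_over k. lift j (f (\<tau> j))) x"
  proof (cases "x \<in> \<Gamma>'")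
    case False
    then show ?thesis
      using sing'D(1)[OF f] by (simp add: sum_fun_apply lift_eq_0 H'_vecs)
  next
    case True
    obtain j \<gamma> where j: "j \<in> cusps_over k" and \<gamma>: "\<gamma> \<in> \<Gamma>" "moebius \<gamma> (as ! j) = moebius x (as' ! k)"
      using exists_cusp_over[OF k True] .
    have jk: "j < length as" "\<kappa> j = k"
      using j by (auto simp: cusps_over_def)
    have c: "\<gamma> \<in> \<Gamma>'" "\<tau> j \<in> \<Gamma>'" "\<gamma> \<in> carrier SL2C" "\<tau> j \<in> carrier SL2C"
      using \<Gamma>_in_\<Gamma>'[OF \<gamma>(1)] \<tau>[OF jk(1)] \<Gamma>'_simps(4) by auto
    have "lift i (f (\<tau> i)) x = 0" if i: "i \<in> cusps_over k - {j}" for i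
    proof -
      have "moebius x (as' ! k) \<in> orbit \<Gamma> (as ! j)"
        using \<gamma> by (force simp: orbit_def)
      then have "moebius x (as' ! \<kappa> i) \<notin> orbit \<Gamma> (as ! i)"
        using orbits_disjoint[of i k j] i j by (auto simp: cusps_over_def)
      then show ?thesis
        by (simp add: lift_eq_0)
    qed
    then have "(\<Sum>i\<in>cusps_over k. lift i (f (\<tau> i)) x) = lift j (f (\<tau> j)) x"
      using j by (subst sum.remove[of _ j]) auto
    also have "\<dots> = \<eta> \<gamma> (f (\<tau> j))"
      using True \<gamma> jk f by (intro lift_eq sing'_value) auto
    also have "\<dots> = f (\<gamma> ** \<tau> j)"
      using H'_vecsD(2)[OF sing'D(1)[OF f]] \<gamma>(1) c(2) by simp
    also have "\<dots> = f x"
      using c \<gamma>(2) True \<tau>_cusp[OF jk(1)] jk(2)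
      by (intro sing'_cong[OF f]) (simp_all add: \<Gamma>'_simps moebius_mult)
    finally show ?thesis
      by (simp add: sum_fun_apply)
  qed
qed

lemma lift_linear_combination:
  assumes "\<And>a. a \<in> A \<Longrightarrow> v a \<in> sing j"
  shows "lift j (\<Sum>a\<in>A. smul H (c a) (v a)) x = (\<Sum>a\<in>A. smul H (c a) (lift j (v a) x))"
proof (cases "x \<in> \<Gamma>' \<and> moebius x (as' ! \<kappa> j) \<in> orbit \<Gamma> (as ! j)")
  case True
  define \<gamma> where "\<gamma> = (SOME \<gamma>. \<gamma> \<in> \<Gamma> \<and> moebius \<gamma> (as ! j) = moebius x (as' ! \<kappa> j))"
  have "\<gamma> \<in> \<Gamma> \<and> moebius \<gamma> (as ! j) = moebius x (as' ! \<kappa> j)"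
    unfolding \<gamma>_def by (rule someI_ex) (use True in \<open>force simp: orbit_def\<close>)
  then show ?thesis
    using True singD(1)[OF assms] by (simp add: lift_def \<eta>_linear_combination flip: \<gamma>_def)
qed (auto simp: lift_def)

end

section \<open>Comparison of the Eisenstein series\<close>

text \<open>The series in \<^const>\<open>eisenstein_continuation\<close>, paired with a single vector \<open>w\<close>.\<close>

definition eisenstein_sum ::
  "cmat2 set \<Rightarrow> 'v hermitian \<Rightarrow> (cmat2 \<Rightarrow> 'v \<Rightarrow> 'v) \<Rightarrow> complex option \<Rightarrow> cmat2 \<Rightarrow> 'v \<Rightarrow> 'v \<Rightarrow>
   hpoint \<Rightarrow> complex \<Rightarrow> complex \<Rightarrow> bool" where
  "eisenstein_sum G H \<rho> \<zeta> \<sigma> v w \<omega> s L \<longleftrightarrow>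
     ((\<lambda>C. let g = (SOME g. g \<in> C) in
        complex_of_real (snd (hyp_act (inv\<^bsub>SL2C\<^esub> \<sigma> ** g) \<omega>)) powr s * ip H (\<rho> (inv\<^bsub>SL2C\<^esub> g) v) w)
      has_sum L) (right_cosets (cusp_stabilizer G \<zeta>) G)"

lemma eisenstein_continuation_alt:
  "eisenstein_continuation G H \<rho> \<zeta> \<sigma> v E \<longleftrightarrow>
     (\<forall>\<omega>\<in>H3. (\<forall>s. E \<omega> s \<in> vecs H) \<and>
       (\<forall>w\<in>vecs H. (\<lambda>s. ip H (E \<omega> s) w) meromorphic_on UNIV \<and>
          (\<forall>s. 2 < Re s \<longrightarrow> eisenstein_sum G H \<rho> \<zeta> \<sigma> v w \<omega> s (ip H (E \<omega> s) w))))"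
  by (simp add: eisenstein_continuation_def eisenstein_sum_def)

lemma has_sum_linear_combination:
  fixes f :: "'a \<Rightarrow> 'b \<Rightarrow> complex"
  assumes "finite A" "\<And>a. a \<in> A \<Longrightarrow> (f a has_sum L a) S"
  shows "((\<lambda>x. \<Sum>a\<in>A. c a * f a x) has_sum (\<Sum>a\<in>A. c a * L a)) S"
  using assms by (induction A rule: finite_induct) (auto intro!: has_sum_add has_sum_cmult_right)

lemma (in ip_space) eisenstein_sum_linear_combination:
  assumes G: "subgroup G SL2C" and A: "finite A"
    and sum: "\<And>a. a \<in> A \<Longrightarrow> eisenstein_sum G H \<rho> \<zeta> \<sigma> (v a) w \<omega> s (L a)"
    and w: "w \<in> vecs H"
    and \<rho>: "\<And>g a. g \<in> G \<Longrightarrow> a \<in> A \<Longrightarrow> \<rho> g (v a) \<in> vecs H"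
    and \<rho>_linear: "\<And>g. g \<in> G \<Longrightarrow> \<rho> g (\<Sum>a\<in>A. smul H (c a) (v a)) = (\<Sum>a\<in>A. smul H (c a) (\<rho> g (v a)))"
  shows "eisenstein_sum G H \<rho> \<zeta> \<sigma> (\<Sum>a\<in>A. smul H (c a) (v a)) w \<omega> s (\<Sum>a\<in>A. c a * L a)"
proof -
  define Y where "Y g = complex_of_real (snd (hyp_act (inv\<^bsub>SL2C\<^esub> \<sigma> ** g) \<omega>)) powr s" for g
  have *: "Y g * ip H (\<rho> (SL2C_inv g) (\<Sum>a\<in>A. smul H (c a) (v a))) w
      = (\<Sum>a\<in>A. c a * (Y g * ip H (\<rho> (SL2C_inv g) (v a)) w))" if "g \<in> G" for g
  proof -
    have g: "SL2C_inv g \<in> G"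
      using that subgroup_SL2C(3)[OF G] by blast
    then show ?thesis
      by (simp add: \<rho>_linear ip_linear_combination \<rho> w sum_distrib_left mult.left_commute)
  qed
  have rep: "(SOME g. g \<in> C) \<in> G" if "C \<in> right_cosets (cusp_stabilizer G \<zeta>) G" for C
    by (rule coset_some(1)[OF subgroup_cusp_stabilizer[OF G] G _ that]) (auto simp: cusp_stabilizer_def)
  have "((\<lambda>C. \<Sum>a\<in>A. c a * (let g = (SOME g. g \<in> C) in Y g * ip H (\<rho> (SL2C_inv g) (v a)) w))
      has_sum (\<Sum>a\<in>A. c a * L a)) (right_cosets (cusp_stabilizer G \<zeta>) G)"
    using A sum unfolding eisenstein_sum_def Y_def by (intro has_sum_linear_combination) auto
  then show ?thesis
    unfolding eisenstein_sum_def Y_def[symmetric] Let_def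
    by (subst has_sum_cong[OF *[OF rep]])
qed

context induction_setting
begin

lemma scaling'D:
  assumes "k < length as'"
  shows "\<sigma>s' ! k \<in> carrier SL2C" "moebius (\<sigma>s' ! k) None = as' ! k"
  using scaling' assms by (auto simp: scaling_matrices_def)

text \<open>The height of \<open>\<omega>\<close> seen from the point \<open>\<xi>\<close> of the \<open>\<Gamma>'\<close>-orbit of a cusp. Any \<open>g\<close> that moves \<open>\<xi>\<close> to the
  cusp gives the same value, since the stabilizer of the cusp preserves heights.\<close>

definition height :: "nat \<Rightarrow> hpoint \<Rightarrow> complex option \<Rightarrow> real" where
  "height k \<omega> \<xi> = snd (hyp_act (SL2C_inv (\<sigma>s' ! k) ** (SOME g. g \<in> \<Gamma>' \<and> moebius g \<xi> = as' ! k)) \<omega>)"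

lemma height_eq:
  assumes k: "k < length as'" and g: "g \<in> \<Gamma>'" and \<omega>: "\<omega> \<in> H3"
  shows "height k \<omega> (moebius (SL2C_inv g) (as' ! k)) = snd (hyp_act (SL2C_inv (\<sigma>s' ! k) ** g) \<omega>)"
proof -
  define h where "h = (SOME h. h \<in> \<Gamma>' \<and> moebius h (moebius (SL2C_inv g) (as' ! k)) = as' ! k)"
  have gc: "g \<in> carrier SL2C"
    using g \<Gamma>'_simps(4) by blast
  have h: "h \<in> \<Gamma>' \<and> moebius h (moebius (SL2C_inv g) (as' ! k)) = as' ! k"
    unfolding h_def by (rule someI[of _ g]) (use g gc in simp)
  have hc: "h \<in> carrier SL2C"
    using h \<Gamma>'_simps(4) by blast
  have "h = (h ** SL2C_inv g) ** g"
    using gc by simp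
  moreover have "snd (hyp_act (SL2C_inv (\<sigma>s' ! k) ** ((h ** SL2C_inv g) ** g)) \<omega>) = snd (hyp_act (SL2C_inv (\<sigma>s' ! k) ** g) \<omega>)"
    using h g gc hc \<omega> scaling'D[OF k]
    by (intro cusp_stabilizer_height[OF \<Gamma>' discrete' cusp_as'[OF k]]) (simp_all add: \<Gamma>'_simps moebius_mult)
  ultimately show ?thesis
    by (simp add: height_def flip: h_def)
qed

lemma orbit_inverse:
  assumes "subgroup G SL2C" "\<xi> \<in> orbit G \<zeta>"
  obtains g where "g \<in> G" "\<xi> = moebius (SL2C_inv g) \<zeta>"
proof -
  obtain g where g: "g \<in> G" "\<xi> = moebius g \<zeta>"
    using assms(2) by (auto simp: orbit_def)
  then have "SL2C_inv (SL2C_inv g) = g"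
    using subgroup_SL2C(4)[OF assms(1)] by simp
  then show ?thesis
    using that[of "SL2C_inv g"] g subgroup_SL2C(3)[OF assms(1)] by simp
qed

lemma height_equivariant:
  assumes k: "k < length as'" and x: "x \<in> \<Gamma>'" and \<omega>: "\<omega> \<in> H3" and \<xi>: "\<xi> \<in> orbit \<Gamma>' (as' ! k)"
  shows "height k (hyp_act x \<omega>) (moebius x \<xi>) = height k \<omega> \<xi>"
proof -
  obtain g where g: "g \<in> \<Gamma>'" "\<xi> = moebius (SL2C_inv g) (as' ! k)"
    using orbit_inverse[OF \<Gamma>' \<xi>] .
  have c: "g \<in> carrier SL2C" "x \<in> carrier SL2C" "\<sigma>s' ! k \<in> carrier SL2C"
    using g x \<Gamma>'_simps(4) scaling'D(1)[OF k] by auto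
  have "moebius x \<xi> = moebius (SL2C_inv (g ** SL2C_inv x)) (as' ! k)"
    using c g(2) by (simp add: SL2C_inv_mult moebius_mult)
  then have "height k (hyp_act x \<omega>) (moebius x \<xi>)
      = snd (hyp_act (SL2C_inv (\<sigma>s' ! k) ** (g ** SL2C_inv x)) (hyp_act x \<omega>))"
    using height_eq[OF k, of "g ** SL2C_inv x" "hyp_act x \<omega>"] g x c \<omega> \<Gamma>'_simps
    by (simp add: hyp_act_in_H3)
  also have "\<dots> = snd (hyp_act (SL2C_inv (\<sigma>s' ! k) ** (g ** SL2C_inv x) ** x) \<omega>)"
    using c \<omega> by (intro height_mult[symmetric]) simp_all
  also have "\<dots> = height k \<omega> \<xi>"
    using c height_eq[OF k g(1) \<omega>] g(2) by (simp add: matrix_mul_assoc)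
  finally show ?thesis .
qed

text \<open>By \<open>sing'_cong\<close> a singular vector is a function of boundary points.\<close>

definition value_at :: "nat \<Rightarrow> (cmat2 \<Rightarrow> 'v) \<Rightarrow> complex option \<Rightarrow> 'v" where
  "value_at k f \<xi> = f (SOME x. x \<in> \<Gamma>' \<and> moebius x (as' ! k) = \<xi>)"

lemma value_at_eq:
  assumes f: "f \<in> sing' k" and x: "x \<in> \<Gamma>'"
  shows "value_at k f (moebius x (as' ! k)) = f x"
proof -
  define y where "y = (SOME y. y \<in> \<Gamma>' \<and> moebius y (as' ! k) = moebius x (as' ! k))"
  have "y \<in> \<Gamma>' \<and> moebius y (as' ! k) = moebius x (as' ! k)"
    unfolding y_def by (rule someI[of _ x]) (use x in simp)
  then show ?thesis
    using sing'_cong[OF f _ x] by (simp add: value_at_def flip: y_def)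
qed

lemma induced_rep_vecs:
  assumes "f \<in> vecs H'" "g \<in> \<Gamma>'"
  shows "induced_rep g f \<in> vecs H'"
proof -
  have gc: "g \<in> carrier SL2C"
    using assms \<Gamma>'_simps(4) by blast
  have out: "x ** g \<notin> \<Gamma>'" if "x \<notin> \<Gamma>'" for x
  proof
    assume "x ** g \<in> \<Gamma>'"
    from \<Gamma>'_simps(2)[OF this \<Gamma>'_simps(3)[OF assms(2)]] show False
      using gc that by simp
  qed
  show ?thesis
    unfolding H'_vecs induced_rep_def
  proof (intro conjI ballI allI impI)
    show "f (x ** g) = 0" if "x \<notin> \<Gamma>'" for x
      using assms(1) out[OF that] by (simp add: H'_vecs)
    show "f (\<gamma> ** x ** g) = \<eta> \<gamma> (f (x ** g))" if "\<gamma> \<in> \<Gamma>" "x \<in> \<Gamma>'" for \<gamma> x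
      unfolding matrix_mul_assoc[symmetric]
      by (rule H'_vecsD(2)[OF assms(1) that(1) \<Gamma>'_simps(2)[OF that(2) assms(2)]])
  qed (rule H'_vecsD(1)[OF assms(1)])
qed

text \<open>The coset of \<open>g\<close> corresponds to the point \<open>\<xi> = g\<^sup>-\<^sup>1 \<zeta>\<close>. As the induced representation is right
  translation, the value of \<open>g\<^sup>-\<^sup>1 f\<close> at \<open>x\<close> is that of \<open>f\<close> at the boundary point \<open>x \<xi>\<close>.\<close>

lemma eisenstein_sum_\<Gamma>':
  assumes k: "k < length as'" and f: "f \<in> sing' k" and \<omega>: "\<omega> \<in> H3"
  shows "eisenstein_sum \<Gamma>' H' induced_rep (as' ! k) (\<sigma>s' ! k) f w \<omega> s L \<longleftrightarrow>
    ((\<lambda>\<xi>. complex_of_real (height k \<omega> \<xi>) powr s *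
        (\<Sum>C\<in>right_cosets \<Gamma> \<Gamma>'. ip H (value_at k f (moebius (rep C) \<xi>)) (w (rep C)))) has_sum L)
     (orbit \<Gamma>' (as' ! k))"
  unfolding eisenstein_sum_def Let_def
proof (rule has_sum_cosets_iff_orbit[OF \<Gamma>', where
      \<Phi> = "\<lambda>g. complex_of_real (snd (hyp_act (SL2C_inv (\<sigma>s' ! k) ** g) \<omega>)) powr s * ip H' (induced_rep (SL2C_inv g) f) w"])
  fix g assume g: "g \<in> \<Gamma>'"
  have "f (rep C ** SL2C_inv g) = value_at k f (moebius (rep C) (moebius (SL2C_inv g) (as' ! k)))"
    if C: "C \<in> right_cosets \<Gamma> \<Gamma>'" for C
  proof -
    have "rep C \<in> carrier SL2C" "g \<in> carrier SL2C" "rep C ** SL2C_inv g \<in> \<Gamma>'"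
      using g rep_coset(1)[OF C] \<Gamma>'_simps by auto
    then show ?thesis
      using value_at_eq[OF f, of "rep C ** SL2C_inv g"] by (simp add: moebius_mult)
  qed
  then show "complex_of_real (snd (hyp_act (SL2C_inv (\<sigma>s' ! k) ** g) \<omega>)) powr s * ip H' (induced_rep (SL2C_inv g) f) w
    = complex_of_real (height k \<omega> (moebius (SL2C_inv g) (as' ! k))) powr s *
       (\<Sum>C\<in>right_cosets \<Gamma> \<Gamma>'. ip H (value_at k f (moebius (rep C) (moebius (SL2C_inv g) (as' ! k)))) (w (rep C)))"
    by (simp add: height_eq[OF k g \<omega>] H'_ip induced_rep_def)
qed

text \<open>Compatibility of the scaling matrices makes the height at the cusp \<open>j\<close> the restriction of the
  height at the cusp below it.\<close>

lemma eisenstein_sum_\<Gamma>: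
  assumes j: "j < length as" and f: "f \<in> sing' (\<kappa> j)" and \<omega>: "\<omega> \<in> H3"
  shows "eisenstein_sum \<Gamma> H \<eta> (as ! j) (\<sigma>s ! j) (f (\<tau> j)) w \<omega> s L \<longleftrightarrow>
    ((\<lambda>\<xi>. complex_of_real (height (\<kappa> j) \<omega> \<xi>) powr s * ip H (value_at (\<kappa> j) f \<xi>) w) has_sum L)
     (orbit \<Gamma> (as ! j))"
  unfolding eisenstein_sum_def Let_def
proof (rule has_sum_cosets_iff_orbit[OF \<Gamma>, where
      \<Phi> = "\<lambda>g. complex_of_real (snd (hyp_act (SL2C_inv (\<sigma>s ! j) ** g) \<omega>)) powr s * ip H (\<eta> (SL2C_inv g) (f (\<tau> j))) w"])
  fix g assume g: "g \<in> \<Gamma>"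
  have g': "g \<in> \<Gamma>'"
    using g by (rule \<Gamma>_in_\<Gamma>')
  have c: "g \<in> carrier SL2C" "\<tau> j \<in> carrier SL2C" "\<sigma>s' ! \<kappa> j \<in> carrier SL2C"
    using g' \<tau>[OF j] \<Gamma>'_simps(4) scaling'D(1)[OF \<kappa>[OF j]] by auto
  have \<xi>: "moebius (SL2C_inv g) (as ! j) = moebius (SL2C_inv g ** \<tau> j) (as' ! \<kappa> j)"
    using c by (simp add: moebius_mult \<tau>_cusp[OF j])
  also have "SL2C_inv g ** \<tau> j = SL2C_inv (SL2C_inv (\<tau> j) ** g)"
    using c by (simp add: SL2C_inv_mult)
  finally have "height (\<kappa> j) \<omega> (moebius (SL2C_inv g) (as ! j))
      = snd (hyp_act (SL2C_inv (\<sigma>s' ! \<kappa> j) ** (SL2C_inv (\<tau> j) ** g)) \<omega>)"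
    using height_eq[OF \<kappa>[OF j] _ \<omega>, of "SL2C_inv (\<tau> j) ** g"] g' \<tau>[OF j] \<Gamma>'_simps by simp
  also have "\<dots> = snd (hyp_act (SL2C_inv (\<sigma>s ! j) ** g) \<omega>)"
    using c by (simp add: \<sigma>_compatible[OF j] SL2C_inv_mult matrix_mul_assoc)
  finally have height: "height (\<kappa> j) \<omega> (moebius (SL2C_inv g) (as ! j)) = snd (hyp_act (SL2C_inv (\<sigma>s ! j) ** g) \<omega>)" .
  have "value_at (\<kappa> j) f (moebius (SL2C_inv g) (as ! j)) = f (SL2C_inv g ** \<tau> j)"
    unfolding \<xi> using g' \<tau>[OF j] \<Gamma>'_simps by (intro value_at_eq[OF f]) blast
  also have "\<dots> = \<eta> (SL2C_inv g) (f (\<tau> j))"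
    using g \<tau>[OF j] \<Gamma>_simps(3) by (intro H'_vecsD(2)[OF sing'D(1)[OF f]]) blast+
  finally show "complex_of_real (snd (hyp_act (SL2C_inv (\<sigma>s ! j) ** g) \<omega>)) powr s * ip H (\<eta> (SL2C_inv g) (f (\<tau> j))) w
     = complex_of_real (height (\<kappa> j) \<omega> (moebius (SL2C_inv g) (as ! j))) powr s *
       ip H (value_at (\<kappa> j) f (moebius (SL2C_inv g) (as ! j))) w"
    by (simp add: height)
qed

lemma moebius_orbit_bij:
  assumes "x \<in> \<Gamma>'"
  shows "bij_betw (moebius x) (orbit \<Gamma>' \<zeta>) (orbit \<Gamma>' \<zeta>)"
proof (rule bij_betw_byWitness[where f' = "moebius (SL2C_inv x)"])
  have xc: "x \<in> carrier SL2C"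
    using assms \<Gamma>'_simps(4) by blast
  then show "\<forall>\<xi>\<in>orbit \<Gamma>' \<zeta>. moebius (SL2C_inv x) (moebius x \<xi>) = \<xi>"
    "\<forall>\<xi>\<in>orbit \<Gamma>' \<zeta>. moebius x (moebius (SL2C_inv x) \<xi>) = \<xi>"
    by simp_all
  have "moebius y \<xi> \<in> orbit \<Gamma>' \<zeta>" if "y \<in> \<Gamma>'" "\<xi> \<in> orbit \<Gamma>' \<zeta>" for y \<xi>
    using that \<Gamma>'_simps by (auto simp: orbit_def moebius_mult[symmetric])
  then show "moebius x ` orbit \<Gamma>' \<zeta> \<subseteq> orbit \<Gamma>' \<zeta>" "moebius (SL2C_inv x) ` orbit \<Gamma>' \<zeta> \<subseteq> orbit \<Gamma>' \<zeta>"
    using assms \<Gamma>'_simps(3) by auto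
qed

text \<open>The value at \<open>x\<close> of the Eisenstein series of the larger group at \<open>\<omega>\<close> is the value at one at the
  point \<open>x \<omega>\<close>, and this is the sum of the Eisenstein series of the smaller group over the cusps above.\<close>

lemma eisenstein_sum_induced:
  assumes k: "k < length as'" and f: "f \<in> sing' k" and \<omega>: "\<omega> \<in> H3"
    and sum: "\<And>C j. C \<in> right_cosets \<Gamma> \<Gamma>' \<Longrightarrow> j \<in> cusps_over k \<Longrightarrow>
      eisenstein_sum \<Gamma> H \<eta> (as ! j) (\<sigma>s ! j) (f (\<tau> j)) (w (rep C)) (hyp_act (rep C) \<omega>) s (L C j)"
  shows "eisenstein_sum \<Gamma>' H' induced_rep (as' ! k) (\<sigma>s' ! k) f w \<omega> s
      (\<Sum>C\<in>right_cosets \<Gamma> \<Gamma>'. \<Sum>j\<in>cusps_over k. L C j)"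
proof -
  have 1: "((\<lambda>\<xi>. complex_of_real (height k \<omega> \<xi>) powr s * ip H (value_at k f (moebius (rep C) \<xi>)) (w (rep C)))
      has_sum (\<Sum>j\<in>cusps_over k. L C j)) (orbit \<Gamma>' (as' ! k))" if C: "C \<in> right_cosets \<Gamma> \<Gamma>'" for C
  proof -
    have x: "rep C \<in> \<Gamma>'"
      by (rule rep_coset(1)[OF C])
    then have \<omega>x: "hyp_act (rep C) \<omega> \<in> H3"
      using \<omega> \<Gamma>'_simps(4) by (simp add: hyp_act_in_H3)
    have "((\<lambda>\<xi>. complex_of_real (height k (hyp_act (rep C) \<omega>) \<xi>) powr s * ip H (value_at k f \<xi>) (w (rep C)))
      has_sum (\<Sum>j\<in>cusps_over k. L C j)) (\<Union>j\<in>cusps_over k. orbit \<Gamma> (as ! j))"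
    proof (rule sum_has_sum)
      fix j assume j: "j \<in> cusps_over k"
      then have jk: "j < length as" "\<kappa> j = k"
        by (auto simp: cusps_over_def)
      show "((\<lambda>\<xi>. complex_of_real (height k (hyp_act (rep C) \<omega>) \<xi>) powr s * ip H (value_at k f \<xi>) (w (rep C)))
          has_sum L C j) (orbit \<Gamma> (as ! j))"
        using sum[OF C j] eisenstein_sum_\<Gamma>[OF jk(1) _ \<omega>x, of f] f jk(2) by simp
    qed (use orbits_disjoint in auto)
    then have "((\<lambda>\<xi>. complex_of_real (height k (hyp_act (rep C) \<omega>) (moebius (rep C) \<xi>)) powr s *
         ip H (value_at k f (moebius (rep C) \<xi>)) (w (rep C)))
      has_sum (\<Sum>j\<in>cusps_over k. L C j)) (orbit \<Gamma>' (as' ! k))"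
      unfolding orbit_decomposition[OF k, symmetric]
      by (subst has_sum_reindex_bij_betw[OF moebius_orbit_bij[OF x]])
    then show ?thesis
      by (subst (asm) has_sum_cong) (simp add: height_equivariant[OF k x \<omega>])
  qed
  have "((\<lambda>\<xi>. \<Sum>C\<in>right_cosets \<Gamma> \<Gamma>'. 1 * (complex_of_real (height k \<omega> \<xi>) powr s * ip H (value_at k f (moebius (rep C) \<xi>)) (w (rep C))))
      has_sum (\<Sum>C\<in>right_cosets \<Gamma> \<Gamma>'. 1 * (\<Sum>j\<in>cusps_over k. L C j))) (orbit \<Gamma>' (as' ! k))"
    by (rule has_sum_linear_combination[OF finite_index 1])
  then show ?thesis
    by (simp add: eisenstein_sum_\<Gamma>'[OF k f \<omega>] sum_distrib_left)
qed

text \<open>Evaluation at one is represented by vectors of the induced space: the one supported on \<open>\<Gamma>\<close>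
  with value \<open>w\<close> at one.\<close>

definition point_mass :: "'v \<Rightarrow> cmat2 \<Rightarrow> 'v" where
  "point_mass w x = (if x \<in> \<Gamma> then \<eta> x w else 0)"

lemma point_mass_vecs:
  assumes "w \<in> vecs H"
  shows "point_mass w \<in> vecs H'"
proof -
  have "\<gamma> ** x \<in> \<Gamma> \<longleftrightarrow> x \<in> \<Gamma>" if "\<gamma> \<in> \<Gamma>" for \<gamma> x
  proof
    assume "\<gamma> ** x \<in> \<Gamma>"
    then have "SL2C_inv \<gamma> ** (\<gamma> ** x) \<in> \<Gamma>"
      using that \<Gamma>_simps by blast
    then show "x \<in> \<Gamma>"
      using that \<Gamma>_simps(4) by (simp add: matrix_mul_assoc)
  qed (use that \<Gamma>_simps(2) in blast)
  then show ?thesis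
    using assms \<Gamma>_in_\<Gamma>' by (auto simp: H'_vecs point_mass_def \<eta>_mult)
qed

lemma ip_point_mass:
  assumes f: "f \<in> vecs H'" and w: "w \<in> vecs H"
  shows "ip H' f (point_mass w) = ip H (f I2) w"
proof -
  have coset_I2: "coset I2 = \<Gamma>"
    by simp
  have I2: "\<Gamma> \<in> right_cosets \<Gamma> \<Gamma>'"
    using coset_in[OF \<Gamma>'_simps(1)] unfolding coset_I2 .
  have "ip H (f (rep C)) (point_mass w (rep C)) = 0" if C: "C \<in> right_cosets \<Gamma> \<Gamma>' - {\<Gamma>}" for C
  proof -
    have "rep C \<notin> \<Gamma>"
    proof
      assume "rep C \<in> \<Gamma>"
      then have "coset (rep C) = coset I2"
        by (intro coset_eq_of_mem[OF \<Gamma>]) simp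
      then show False
        using rep_coset(2)[of C] C unfolding coset_I2 by simp
    qed
    then show ?thesis
      using f by (simp add: point_mass_def H'_vecsD)
  qed
  then have "ip H' f (point_mass w) = ip H (f (rep \<Gamma>)) (point_mass w (rep \<Gamma>))"
    unfolding H'_ip using I2 finite_index by (subst sum.remove[OF _ I2]) auto
  moreover have r: "rep \<Gamma> \<in> \<Gamma>"
    using \<Gamma>_simps(1) by (rule someI)
  moreover have "f (rep \<Gamma> ** I2) = \<eta> (rep \<Gamma>) (f I2)"
    using r \<Gamma>'_simps(1) by (intro H'_vecsD(2)[OF f]) auto
  ultimately show ?thesis
    using f w by (simp add: point_mass_def \<eta>_ip H'_vecsD)
qed

text \<open>The lift of \<open>v\<close> is supported over the orbit of the cusp \<open>j\<close>, so its Eisenstein series, evaluated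
  at one, is the Eisenstein series of \<open>v\<close>.\<close>

lemma eisenstein_sum_restrict:
  assumes j: "j < length as" and v: "v \<in> sing j" and w: "w \<in> vecs H" and \<omega>: "\<omega> \<in> H3"
    and sum: "eisenstein_sum \<Gamma>' H' induced_rep (as' ! \<kappa> j) (\<sigma>s' ! \<kappa> j) (lift j v) (point_mass w) \<omega> s L"
  shows "eisenstein_sum \<Gamma> H \<eta> (as ! j) (\<sigma>s ! j) v w \<omega> s L"
proof -
  define f where "f = lift j v"
  have f: "f \<in> sing' (\<kappa> j)"
    unfolding f_def by (rule lift_sing'[OF v])
  have k: "\<kappa> j < length as'"
    by (rule \<kappa>[OF j])
  have "(\<Sum>C\<in>right_cosets \<Gamma> \<Gamma>'. ip H (value_at (\<kappa> j) f (moebius (rep C) \<xi>)) (point_mass w (rep C)))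
      = ip H (value_at (\<kappa> j) f \<xi>) w" if \<xi>: "\<xi> \<in> orbit \<Gamma>' (as' ! \<kappa> j)" for \<xi>
  proof -
    obtain x where x: "x \<in> \<Gamma>'" "\<xi> = moebius x (as' ! \<kappa> j)"
      using \<xi> by (auto simp: orbit_def)
    have "value_at (\<kappa> j) f (moebius (rep C) \<xi>) = induced_rep x f (rep C)" if C: "C \<in> right_cosets \<Gamma> \<Gamma>'" for C
      using value_at_eq[OF f, of "rep C ** x"] x rep_coset(1)[OF C] \<Gamma>'_simps
      by (simp add: moebius_mult induced_rep_def)
    then have "(\<Sum>C\<in>right_cosets \<Gamma> \<Gamma>'. ip H (value_at (\<kappa> j) f (moebius (rep C) \<xi>)) (point_mass w (rep C)))
       = ip H' (induced_rep x f) (point_mass w)"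
      by (simp add: H'_ip)
    also have "\<dots> = ip H (f x) w"
      using ip_point_mass[OF induced_rep_vecs[OF sing'D(1)[OF f] x(1)] w] by (simp add: induced_rep_def)
    finally show ?thesis
      using value_at_eq[OF f x(1)] x(2) by simp
  qed
  then have "((\<lambda>\<xi>. complex_of_real (height (\<kappa> j) \<omega> \<xi>) powr s * ip H (value_at (\<kappa> j) f \<xi>) w) has_sum L)
      (orbit \<Gamma>' (as' ! \<kappa> j))"
    using sum unfolding f_def[symmetric] eisenstein_sum_\<Gamma>'[OF k f \<omega>]
    by (subst (asm) has_sum_cong) auto
  also have "?this \<longleftrightarrow> ((\<lambda>\<xi>. complex_of_real (height (\<kappa> j) \<omega> \<xi>) powr s * ip H (value_at (\<kappa> j) f \<xi>) w) has_sum L)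
      (orbit \<Gamma> (as ! j))"
  proof (rule has_sum_cong_neutral)
    fix \<xi> assume "\<xi> \<in> orbit \<Gamma> (as ! j) - orbit \<Gamma>' (as' ! \<kappa> j)"
    moreover have "j \<in> cusps_over (\<kappa> j)"
      using j by (simp add: cusps_over_def)
    ultimately have False
      unfolding orbit_decomposition[OF k] by blast
    then show "complex_of_real (height (\<kappa> j) \<omega> \<xi>) powr s * ip H (value_at (\<kappa> j) f \<xi>) w = 0" ..
  next
    fix \<xi> assume \<xi>: "\<xi> \<in> orbit \<Gamma>' (as' ! \<kappa> j) - orbit \<Gamma> (as ! j)"
    then obtain x where x: "x \<in> \<Gamma>'" "\<xi> = moebius x (as' ! \<kappa> j)"
      by (auto simp: orbit_def)
    then have "f x = 0"
      using \<xi> by (auto simp: f_def intro: lift_eq_0)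
    then have "value_at (\<kappa> j) f \<xi> = 0"
      using value_at_eq[OF f x(1)] x(2) by simp
    then show "complex_of_real (height (\<kappa> j) \<omega> \<xi>) powr s * ip H (value_at (\<kappa> j) f \<xi>) w = 0"
      using w by simp
  qed simp
  finally show ?thesis
    using eisenstein_sum_\<Gamma>[OF j f \<omega>] lift_value[OF v j j] by (simp add: f_def)
qed

end

section \<open>Change of basis\<close>

lemma (in vector_space) sum_scale_mat_mult:
  assumes M: "M \<in> carrier_mat a b" and N: "N \<in> carrier_mat b c" and i: "i < a"
  shows "(\<Sum>k<c. scale ((M * N) $$ (i, k)) (v k)) = (\<Sum>j<b. scale (M $$ (i, j)) (\<Sum>k<c. scale (N $$ (j, k)) (v k)))"
proof -
  have "(\<Sum>k<c. scale ((M * N) $$ (i, k)) (v k)) = (\<Sum>k<c. \<Sum>j<b. scale (M $$ (i, j)) (scale (N $$ (j, k)) (v k)))"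
    using M N i by (intro sum.cong)
      (auto simp: index_mult_mat scalar_prod_def scale_sum_left atLeast0LessThan)
  also have "\<dots> = (\<Sum>j<b. scale (M $$ (i, j)) (\<Sum>k<c. scale (N $$ (j, k)) (v k)))"
    by (subst sum.swap) (simp add: scale_sum_right)
  finally show ?thesis .
qed

text \<open>In matrix form, \<open>e = S u\<close> implies \<open>A e = A S (B A) u = (A S B) (A u)\<close>.\<close>

lemma (in vector_space) conjugate_relation:
  assumes A: "A \<in> carrier_mat n' n" and B: "B \<in> carrier_mat n n'" and S: "S \<in> carrier_mat n n"
    and BA: "B * A = 1\<^sub>m n"
    and e: "\<And>i. i < n \<Longrightarrow> e i = (\<Sum>k<n. scale (S $$ (i, k)) (u k))" and i: "i < n'"
  shows "(\<Sum>k<n. scale (A $$ (i, k)) (e k))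
       = (\<Sum>m<n'. scale ((A * S * B) $$ (i, m)) (\<Sum>k<n. scale (A $$ (m, k)) (u k)))"
proof -
  have "(\<Sum>m<n'. scale ((A * S * B) $$ (i, m)) (\<Sum>k<n. scale (A $$ (m, k)) (u k)))
      = (\<Sum>k<n. scale ((A * S * B * A) $$ (i, k)) (u k))"
    using A B S i by (intro sum_scale_mat_mult[symmetric]) auto
  also have "A * S * B * A = A * S * (B * A)"
    using A B S by (intro assoc_mult_mat) auto
  also have "\<dots> = A * S"
    using A S unfolding BA by (intro right_mult_one_mat) auto
  also have "(\<Sum>k<n. scale ((A * S) $$ (i, k)) (u k)) = (\<Sum>k<n. scale (A $$ (i, k)) (e k))"
    using A S i e by (subst sum_scale_mat_mult[of A n' n S n]) auto
  finally show ?thesis ..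
qed

text \<open>Both products have the same trace.\<close>

lemma mutually_inverse_mat_square:
  fixes A B :: "complex Matrix.mat"
  assumes A: "A \<in> carrier_mat n' n" and B: "B \<in> carrier_mat n n'"
    and "A * B = 1\<^sub>m n'" "B * A = 1\<^sub>m n"
  shows "n' = n"
proof -
  have "of_nat n' = (\<Sum>i<n'. (A * B) $$ (i, i))"
    using assms(3) by simp
  also have "\<dots> = (\<Sum>i<n'. \<Sum>k<n. A $$ (i, k) * B $$ (k, i))"
    using A B by (intro sum.cong) (auto simp: index_mult_mat scalar_prod_def atLeast0LessThan)
  also have "\<dots> = (\<Sum>k<n. \<Sum>i<n'. B $$ (k, i) * A $$ (i, k))"
    by (subst sum.swap) (simp add: mult.commute)
  also have "\<dots> = (\<Sum>k<n. (B * A) $$ (k, k))"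
    using A B by (intro sum.cong) (auto simp: index_mult_mat scalar_prod_def atLeast0LessThan)
  also have "\<dots> = of_nat n"
    using assms(4) by simp
  finally show ?thesis
    by (simp only: of_nat_eq_iff)
qed

lemma det_conjugate:
  fixes A B S :: "complex Matrix.mat"
  assumes A: "A \<in> carrier_mat n' n" and B: "B \<in> carrier_mat n n'" and S: "S \<in> carrier_mat n n"
    and AB: "A * B = 1\<^sub>m n'" and BA: "B * A = 1\<^sub>m n"
  shows "Determinant.det (A * S * B) = Determinant.det S"
proof -
  have n: "n' = n"
    by (rule mutually_inverse_mat_square[OF A B AB BA])
  have "Determinant.det (A * S * B) = Determinant.det A * Determinant.det S * Determinant.det B"
    using A B S n by (subst det_mult[of _ n]; simp add: det_mult[of _ n])
  also have "\<dots> = Determinant.det S * Determinant.det (A * B)"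
    using A B n by (simp add: det_mult[of _ n])
  finally show ?thesis
    using AB by simp
qed

lemma meromorphic_conjugate_entry:
  fixes A B :: "complex Matrix.mat"
  assumes A: "A \<in> carrier_mat n' n" and B: "B \<in> carrier_mat n n'" and S: "\<And>s. S s \<in> carrier_mat n n"
    and mero: "\<And>i k. i < n \<Longrightarrow> k < n \<Longrightarrow> (\<lambda>s. S s $$ (i, k)) meromorphic_on UNIV"
    and "i < n'" "m < n'"
  shows "(\<lambda>s. (A * S s * B) $$ (i, m)) meromorphic_on UNIV"
proof -
  have "(A * S s * B) $$ (i, m) = (\<Sum>j<n. A $$ (i, j) * (\<Sum>k<n. S s $$ (j, k) * B $$ (k, m)))" for s
    using A B S[of s] assms(5,6)
    by (simp add: index_mult_mat scalar_prod_def atLeast0LessThan)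
  then show ?thesis
    by (auto intro!: meromorphic_on_sum meromorphic_on_mult mero)
qed

lemma set_eisenstein_index:
  "set (eisenstein_index Bs) = (SIGMA j:{..<length Bs}. {..<length (Bs ! j)})"
  by (auto simp: eisenstein_index_def)

lemma distinct_eisenstein_index: "distinct (eisenstein_index Bs)"
proof -
  have "distinct (concat (map (\<lambda>j. map (Pair j) [0..<length (Bs ! j)]) [0..<n]))" for n
    by (induction n) (auto simp: distinct_map inj_on_def)
  then show ?thesis
    by (simp add: eisenstein_index_def)
qed

lemma sum_eisenstein_index:
  "(\<Sum>k<length (eisenstein_index Bs). g (eisenstein_index Bs ! k)) = (\<Sum>q\<in>set (eisenstein_index Bs). g q)"
  by (intro sum.reindex_bij_betw bij_betw_nth distinct_eisenstein_index) auto

lemma sum_eisenstein_index_nested: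
  "(\<Sum>q\<in>set (eisenstein_index Bs). g q) = (\<Sum>j<length Bs. \<Sum>l<length (Bs ! j). g (j, l))"
  by (subst sum.Sigma) (auto simp: set_eisenstein_index)

locale induction_bases = induction_setting H \<Gamma> \<Gamma>' \<eta> as as' \<sigma>s \<sigma>s' \<kappa> \<tau>
  for H :: "'v::ab_group_add hermitian" and \<Gamma> \<Gamma>' \<eta> as as' \<sigma>s \<sigma>s' \<kappa> \<tau> +
  fixes Bs :: "'v list list" and Bs' :: "(cmat2 \<Rightarrow> 'v) list list"
  assumes bases: "singular_bases \<Gamma> H \<eta> as Bs"
    and bases': "singular_bases \<Gamma>' H' induced_rep as' Bs'"
begin

abbreviation "ix \<equiv> eisenstein_index Bs"
abbreviation "ix' \<equiv> eisenstein_index Bs'"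

lemma length_Bs [simp]: "length Bs = length as" "length Bs' = length as'"
  using bases bases' by (simp_all add: singular_bases_def)

lemma basis: "j < length as \<Longrightarrow> orthonormal_basis H (sing j) (Bs ! j)"
  and basis': "k < length as' \<Longrightarrow> orthonormal_basis H' (sing' k) (Bs' ! k)"
  using bases bases' by (simp_all add: singular_bases_def)

lemma basis_mem: "j < length as \<Longrightarrow> l < length (Bs ! j) \<Longrightarrow> Bs ! j ! l \<in> sing j"
  and basis'_mem: "k < length as' \<Longrightarrow> m < length (Bs' ! k) \<Longrightarrow> Bs' ! k ! m \<in> sing' k"
  using orthonormal_basis_mem[OF basis] H'.orthonormal_basis_mem[OF basis'] by simp_all

lemma mem_ix: "(j, l) \<in> set ix \<longleftrightarrow> j < length as \<and> l < length (Bs ! j)"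
  and mem_ix': "(k, m) \<in> set ix' \<longleftrightarrow> k < length as' \<and> m < length (Bs' ! k)"
  by (auto simp: set_eisenstein_index)

text \<open>The matrix of \<open>f \<mapsto> (f(\<tau>\<^sub>j))\<^sub>j\<close> with respect to the chosen bases, indexed by pairs of a cusp and a
  basis vector, and the matrix of its inverse \<open>lift\<close>.\<close>

fun value_coeff :: "nat \<times> nat \<Rightarrow> nat \<times> nat \<Rightarrow> complex" where
  "value_coeff (k, m) (j, l) = (if \<kappa> j = k then ip H ((Bs' ! k ! m) (\<tau> j)) (Bs ! j ! l) else 0)"

fun lift_coeff :: "nat \<times> nat \<Rightarrow> nat \<times> nat \<Rightarrow> complex" where
  "lift_coeff (j, l) (k, m) = (if \<kappa> j = k then ip H' (lift j (Bs ! j ! l)) (Bs' ! k ! m) else 0)"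

lemma value_expansion:
  assumes "j < length as" "m < length (Bs' ! \<kappa> j)"
  shows "(Bs' ! \<kappa> j ! m) (\<tau> j) = (\<Sum>l<length (Bs ! j). smul H (value_coeff (\<kappa> j, m) (j, l)) (Bs ! j ! l))"
  using orthonormal_expansion[OF basis[OF assms(1)] _ sing'_value[OF basis'_mem[OF \<kappa>[OF assms(1)] assms(2)] assms(1)]]
    singD(1) by auto

lemma lift_expansion:
  assumes "j < length as" "l < length (Bs ! j)"
  shows "lift j (Bs ! j ! l) = (\<Sum>m<length (Bs' ! \<kappa> j). smul H' (lift_coeff (j, l) (\<kappa> j, m)) (Bs' ! \<kappa> j ! m))"
  using H'.orthonormal_expansion[OF basis'[OF \<kappa>[OF assms(1)]] _ lift_sing'[OF basis_mem[OF assms]]]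
    sing'D(1) by auto

lemma sum_value_coeff:
  fixes X :: "nat \<times> nat \<Rightarrow> complex"
  assumes "(k, m) \<in> set ix'"
  shows "(\<Sum>q\<in>set ix. value_coeff (k, m) q * X q) = (\<Sum>j\<in>cusps_over k. \<Sum>l<length (Bs ! j). value_coeff (k, m) (j, l) * X (j, l))"
  unfolding sum_eisenstein_index_nested
  by (intro sum.mono_neutral_right) (auto simp: cusps_over_def)

lemma sum_lift_coeff:
  fixes X :: "nat \<times> nat \<Rightarrow> complex"
  assumes "(j, l) \<in> set ix"
  shows "(\<Sum>p\<in>set ix'. lift_coeff (j, l) p * X p) = (\<Sum>m<length (Bs' ! \<kappa> j). lift_coeff (j, l) (\<kappa> j, m) * X (\<kappa> j, m))"
proof -
  have "\<kappa> j < length as'"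
    using assms \<kappa> by (simp add: mem_ix)
  then have "(\<Sum>p\<in>set ix'. lift_coeff (j, l) p * X p)
      = (\<Sum>k\<in>{\<kappa> j}. \<Sum>m<length (Bs' ! k). lift_coeff (j, l) (k, m) * X (k, m))"
    unfolding sum_eisenstein_index_nested by (intro sum.mono_neutral_right) auto
  then show ?thesis
    by simp
qed

text \<open>This is \<open>sing'_decomposition\<close> in coordinates.\<close>

lemma value_lift_coeff:
  assumes p: "p \<in> set ix'" and r: "r \<in> set ix'"
  shows "(\<Sum>q\<in>set ix. value_coeff p q * lift_coeff q r) = (if p = r then 1 else 0)"
proof -
  obtain k m k2 m2 where pr: "p = (k, m)" "r = (k2, m2)"
    by (cases p, cases r) auto
  have k: "k < length as'" "m < length (Bs' ! k)" and k2: "k2 < length as'" "m2 < length (Bs' ! k2)"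
    using p r by (auto simp: pr mem_ix')
  define f h where "f = Bs' ! k ! m" and "h = Bs' ! k2 ! m2"
  have f: "f \<in> sing' k" and h: "h \<in> vecs H'"
    using basis'_mem[OF k] sing'D(1)[OF basis'_mem[OF k2]] by (auto simp: f_def h_def)
  show ?thesis
  proof (cases "k = k2")
    case False
    then have "value_coeff (k, m) q * lift_coeff q (k2, m2) = 0" for q
      by (cases q) auto
    then have "(\<Sum>q\<in>set ix. value_coeff p q * lift_coeff q r) = 0"
      unfolding pr by (intro sum.neutral) blast
    then show ?thesis
      using False by (simp add: pr)
  next
    case True
    have "(\<Sum>q\<in>set ix. value_coeff p q * lift_coeff q r)
        = (\<Sum>j\<in>cusps_over k. \<Sum>l<length (Bs ! j). value_coeff (k, m) (j, l) * lift_coeff (j, l) (k2, m2))"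
      using p unfolding pr by (rule sum_value_coeff)
    also have "\<dots> = (\<Sum>j\<in>cusps_over k. ip H' (lift j (f (\<tau> j))) h)"
    proof (rule sum.cong[OF refl])
      fix j assume "j \<in> cusps_over k"
      then have j: "j < length as" "\<kappa> j = k"
        by (auto simp: cusps_over_def)
      have "lift j (f (\<tau> j)) = (\<Sum>l<length (Bs ! j). smul H' (value_coeff (k, m) (j, l)) (lift j (Bs ! j ! l)))"
        unfolding f_def value_expansion[OF j(1), unfolded j(2), OF k(2)]
        unfolding fun_eq_iff sum_fun_apply H'_smul
        by (intro allI lift_linear_combination basis_mem[OF j(1)]) simp
      moreover have "lift j (Bs ! j ! l) \<in> vecs H'" if "l < length (Bs ! j)" for l
        by (rule sing'D(1)[OF lift_sing'[OF basis_mem[OF j(1) that]]])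
      ultimately have "ip H' (lift j (f (\<tau> j))) h
          = (\<Sum>l<length (Bs ! j). value_coeff (k, m) (j, l) * ip H' (lift j (Bs ! j ! l)) h)"
        using h by (simp only:, intro H'.ip_linear_combination) auto
      then show "(\<Sum>l<length (Bs ! j). value_coeff (k, m) (j, l) * lift_coeff (j, l) (k2, m2)) = ip H' (lift j (f (\<tau> j))) h"
        using j(2) True by (simp add: h_def)
    qed
    also have "\<dots> = ip H' (\<Sum>j\<in>cusps_over k. lift j (f (\<tau> j))) h"
      using f h by (intro H'.ip_sum[symmetric] sing'D(1)[OF lift_sing'] sing'_value)
        (auto simp: cusps_over_def)
    also have "(\<Sum>j\<in>cusps_over k. lift j (f (\<tau> j))) = f"
      using sing'_decomposition[OF k(1) f] ..
    also have "ip H' f h = (if p = r then 1 else 0)"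
      using basis'[OF k(1)] k k2 True by (auto simp: orthonormal_basis_def f_def h_def pr)
    finally show ?thesis .
  qed
qed

text \<open>This is \<open>lift_value\<close> in coordinates.\<close>

lemma lift_value_coeff:
  assumes p: "p \<in> set ix" and r: "r \<in> set ix"
  shows "(\<Sum>q\<in>set ix'. lift_coeff p q * value_coeff q r) = (if p = r then 1 else 0)"
proof -
  obtain j l i m where pr: "p = (j, l)" "r = (i, m)"
    by (cases p, cases r) auto
  have j: "j < length as" "l < length (Bs ! j)" and i: "i < length as" "m < length (Bs ! i)"
    using p r by (auto simp: pr mem_ix)
  define v w where "v = Bs ! j ! l" and "w = Bs ! i ! m"
  have v: "v \<in> sing j" and w: "w \<in> vecs H"
    using basis_mem[OF j] singD(1)[OF basis_mem[OF i]] by (auto simp: v_def w_def)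
  show ?thesis
  proof (cases "\<kappa> i = \<kappa> j")
    case False
    then have "lift_coeff (j, l) q * value_coeff q (i, m) = 0" for q
      by (cases q) auto
    then have "(\<Sum>q\<in>set ix'. lift_coeff p q * value_coeff q r) = 0"
      unfolding pr by (intro sum.neutral) blast
    then show ?thesis
      using False by (auto simp: pr)
  next
    case True
    have "(\<Sum>q\<in>set ix'. lift_coeff p q * value_coeff q r)
        = (\<Sum>n<length (Bs' ! \<kappa> j). lift_coeff (j, l) (\<kappa> j, n) * value_coeff (\<kappa> j, n) (i, m))"
      using p unfolding pr by (rule sum_lift_coeff)
    also have "\<dots> = (\<Sum>n<length (Bs' ! \<kappa> j). lift_coeff (j, l) (\<kappa> j, n) * ip H ((Bs' ! \<kappa> j ! n) (\<tau> i)) w)"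
      using True by (simp add: w_def)
    also have "\<dots> = ip H (\<Sum>n<length (Bs' ! \<kappa> j). smul H (lift_coeff (j, l) (\<kappa> j, n)) ((Bs' ! \<kappa> j ! n) (\<tau> i))) w"
      using w H'_vecsD(1)[OF sing'D(1)[OF basis'_mem[OF \<kappa>[OF j(1)]]]]
      by (intro ip_linear_combination[symmetric]) auto
    also have "(\<Sum>n<length (Bs' ! \<kappa> j). smul H (lift_coeff (j, l) (\<kappa> j, n)) ((Bs' ! \<kappa> j ! n) (\<tau> i))) = lift j v (\<tau> i)"
      unfolding v_def lift_expansion[OF j] by (simp add: sum_fun_apply H'_smul)
    also have "ip H (lift j v (\<tau> i)) w = (if p = r then 1 else 0)"
      using basis[OF i(1)] j i w unfolding lift_value[OF v j(1) i(1) True]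
      by (auto simp: orthonormal_basis_def v_def w_def pr)
    finally show ?thesis .
  qed
qed

definition A :: "complex Matrix.mat" where
  "A = Matrix.mat (length ix') (length ix) (\<lambda>(i, k). value_coeff (ix' ! i) (ix ! k))"

definition B :: "complex Matrix.mat" where
  "B = Matrix.mat (length ix) (length ix') (\<lambda>(k, i). lift_coeff (ix ! k) (ix' ! i))"

lemma A_carrier [simp]: "A \<in> carrier_mat (length ix') (length ix)"
  and B_carrier [simp]: "B \<in> carrier_mat (length ix) (length ix')"
  by (simp_all add: A_def B_def)

lemma A_B: "A * B = 1\<^sub>m (length ix')"
proof (rule eq_matI)
  fix i m assume "i < dim_row (1\<^sub>m (length ix') :: complex Matrix.mat)" "m < dim_col (1\<^sub>m (length ix') :: complex Matrix.mat)"
  then have im: "i < length ix'" "m < length ix'"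
    by simp_all
  then have "(A * B) $$ (i, m) = (\<Sum>k<length ix. value_coeff (ix' ! i) (ix ! k) * lift_coeff (ix ! k) (ix' ! m))"
    by (simp add: A_def B_def index_mult_mat scalar_prod_def atLeast0LessThan)
  also have "\<dots> = (if ix' ! i = ix' ! m then 1 else 0)"
    using im unfolding sum_eisenstein_index[of "\<lambda>q. value_coeff (ix' ! i) q * lift_coeff q (ix' ! m)"]
    by (intro value_lift_coeff) simp_all
  finally show "(A * B) $$ (i, m) = 1\<^sub>m (length ix') $$ (i, m)"
    using im distinct_eisenstein_index[of Bs'] by (simp add: nth_eq_iff_index_eq)
qed (simp_all add: A_def B_def)

lemma B_A: "B * A = 1\<^sub>m (length ix)"
proof (rule eq_matI)
  fix i m assume "i < dim_row (1\<^sub>m (length ix) :: complex Matrix.mat)" "m < dim_col (1\<^sub>m (length ix) :: complex Matrix.mat)"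
  then have im: "i < length ix" "m < length ix"
    by simp_all
  then have "(B * A) $$ (i, m) = (\<Sum>k<length ix'. lift_coeff (ix ! i) (ix' ! k) * value_coeff (ix' ! k) (ix ! m))"
    by (simp add: A_def B_def index_mult_mat scalar_prod_def atLeast0LessThan)
  also have "\<dots> = (if ix ! i = ix ! m then 1 else 0)"
    using im unfolding sum_eisenstein_index[of "\<lambda>q. lift_coeff (ix ! i) q * value_coeff q (ix ! m)"]
    by (intro lift_value_coeff) simp_all
  finally show "(B * A) $$ (i, m) = 1\<^sub>m (length ix) $$ (i, m)"
    using im distinct_eisenstein_index[of Bs] by (simp add: nth_eq_iff_index_eq)
qed (simp_all add: A_def B_def)

section \<open>Transfer of the scattering matrix\<close>

text \<open>A meromorphic continuation may take arbitrary values at a discrete set of \<open>s\<close>, where the Eisenstein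
  series of \<open>\<Gamma>\<close> need not be automorphic. Therefore \<open>E'(\<omega>, s)(x) = \<Sum>\<^sub>q A\<^sub>p\<^sub>q E\<^sub>q(x \<omega>, s)\<close> serves as definition
  for the coset representatives only; extending these values keeps \<open>E'(\<omega>, s)\<close> in the induced space for
  every \<open>s\<close>.\<close>

definition induced_eisenstein ::
  "(nat \<times> nat \<Rightarrow> hpoint \<Rightarrow> complex \<Rightarrow> 'v) \<Rightarrow> nat \<times> nat \<Rightarrow> hpoint \<Rightarrow> complex \<Rightarrow> cmat2 \<Rightarrow> 'v" where
  "induced_eisenstein E p \<omega> s = extend (\<lambda>x. \<Sum>q\<in>set ix. smul H (value_coeff p q) (E q (hyp_act x \<omega>) s))"

text \<open>The inverse change of basis, followed by evaluation at one.\<close>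

definition restricted_eisenstein ::
  "(nat \<times> nat \<Rightarrow> hpoint \<Rightarrow> complex \<Rightarrow> cmat2 \<Rightarrow> 'v) \<Rightarrow> nat \<times> nat \<Rightarrow> hpoint \<Rightarrow> complex \<Rightarrow> 'v" where
  "restricted_eisenstein E q \<omega> s = (\<Sum>p\<in>set ix'. smul H (lift_coeff q p) (E p \<omega> s I2))"

lemma induced_eisenstein_rep:
  assumes E: "\<And>q \<omega>. q \<in> set ix \<Longrightarrow> \<omega> \<in> H3 \<Longrightarrow> E q \<omega> s \<in> vecs H" and \<omega>: "\<omega> \<in> H3"
  shows "induced_eisenstein E p \<omega> s \<in> vecs H'"
    and "C \<in> right_cosets \<Gamma> \<Gamma>' \<Longrightarrow>
      induced_eisenstein E p \<omega> s (rep C) = (\<Sum>q\<in>set ix. smul H (value_coeff p q) (E q (hyp_act (rep C) \<omega>) s))"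
proof -
  have *: "(\<Sum>q\<in>set ix. smul H (value_coeff p q) (E q (hyp_act x \<omega>) s)) \<in> vecs H" if "x \<in> \<Gamma>'" for x
    using that \<omega> \<Gamma>'_simps(4) by (intro vecs_sum vecs_smul E) (simp_all add: hyp_act_in_H3)
  show "induced_eisenstein E p \<omega> s \<in> vecs H'"
    unfolding induced_eisenstein_def by (rule extend_vecs[OF *])
  show "induced_eisenstein E p \<omega> s (rep C) = (\<Sum>q\<in>set ix. smul H (value_coeff p q) (E q (hyp_act (rep C) \<omega>) s))"
    if "C \<in> right_cosets \<Gamma> \<Gamma>'"
    unfolding induced_eisenstein_def
    using extend_rep[OF that, of "\<lambda>x. \<Sum>q\<in>set ix. smul H (value_coeff p q) (E q (hyp_act x \<omega>) s)"]
      *[OF rep_coset(1)[OF that]] by simp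
qed

lemma induced_eisenstein_continuation:
  assumes E: "\<And>j l. (j, l) \<in> set ix \<Longrightarrow>
      eisenstein_continuation \<Gamma> H \<eta> (as ! j) (\<sigma>s ! j) (Bs ! j ! l) (E (j, l))"
    and km: "(k, m) \<in> set ix'"
  shows "eisenstein_continuation \<Gamma>' H' induced_rep (as' ! k) (\<sigma>s' ! k) (Bs' ! k ! m)
    (induced_eisenstein E (k, m))"
  unfolding eisenstein_continuation_alt
proof (intro ballI conjI allI impI)
  have E_vecs: "E q \<omega> s \<in> vecs H" if "q \<in> set ix" "\<omega> \<in> H3" for q \<omega> s
    using E[of "fst q" "snd q"] that by (auto simp: eisenstein_continuation_alt)
  fix \<omega> assume \<omega>: "\<omega> \<in> H3"
  show "induced_eisenstein E (k, m) \<omega> s \<in> vecs H'" for s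
    using E_vecs \<omega> by (rule induced_eisenstein_rep(1))
  fix w assume w: "w \<in> vecs H'"
  have wC: "w x \<in> vecs H" for x
    by (rule H'_vecsD(1)[OF w])
  have \<omega>C: "hyp_act (rep C) \<omega> \<in> H3" if "C \<in> right_cosets \<Gamma> \<Gamma>'" for C
    using rep_coset(1)[OF that] \<omega> \<Gamma>'_simps(4) by (simp add: hyp_act_in_H3)
  have ip_eq: "ip H' (induced_eisenstein E (k, m) \<omega> s) w
      = (\<Sum>C\<in>right_cosets \<Gamma> \<Gamma>'. \<Sum>q\<in>set ix. value_coeff (k, m) q * ip H (E q (hyp_act (rep C) \<omega>) s) (w (rep C)))" for s
    unfolding H'_ip
  proof (rule sum.cong[OF refl])
    fix C assume C: "C \<in> right_cosets \<Gamma> \<Gamma>'"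
    have rep: "induced_eisenstein E (k, m) \<omega> s (rep C)
        = (\<Sum>q\<in>set ix. smul H (value_coeff (k, m) q) (E q (hyp_act (rep C) \<omega>) s))"
      using E_vecs \<omega> C by (intro induced_eisenstein_rep(2)) auto
    show "ip H (induced_eisenstein E (k, m) \<omega> s (rep C)) (w (rep C)) =
      (\<Sum>q\<in>set ix. value_coeff (k, m) q * ip H (E q (hyp_act (rep C) \<omega>) s) (w (rep C)))"
      unfolding rep
      by (intro ip_linear_combination E_vecs \<omega>C[OF C] wC)
  qed
  show "(\<lambda>s. ip H' (induced_eisenstein E (k, m) \<omega> s) w) meromorphic_on UNIV"
    unfolding ip_eq
  proof (intro meromorphic_on_sum meromorphic_on_mult meromorphic_on_const)
    fix C q assume "C \<in> right_cosets \<Gamma> \<Gamma>'" "q \<in> set ix"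
    then show "(\<lambda>s. ip H (E q (hyp_act (rep C) \<omega>) s) (w (rep C))) meromorphic_on UNIV"
      using E[of "fst q" "snd q"] \<omega>C wC by (simp add: eisenstein_continuation_alt)
  qed
  fix s :: complex assume s: "2 < Re s"
  have k: "k < length as'" "m < length (Bs' ! k)"
    using km by (auto simp: mem_ix')
  have "eisenstein_sum \<Gamma>' H' induced_rep (as' ! k) (\<sigma>s' ! k) (Bs' ! k ! m) w \<omega> s
      (\<Sum>C\<in>right_cosets \<Gamma> \<Gamma>'. \<Sum>j\<in>cusps_over k. \<Sum>l<length (Bs ! j).
         value_coeff (k, m) (j, l) * ip H (E (j, l) (hyp_act (rep C) \<omega>) s) (w (rep C)))"
  proof (rule eisenstein_sum_induced[OF k(1) basis'_mem[OF k] \<omega>])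
    fix C j assume C: "C \<in> right_cosets \<Gamma> \<Gamma>'" and "j \<in> cusps_over k"
    then have j: "j < length as" "\<kappa> j = k"
      by (auto simp: cusps_over_def)
    have v: "Bs ! j ! l \<in> vecs H" if "l < length (Bs ! j)" for l
      by (rule singD(1)[OF basis_mem[OF j(1) that]])
    show "eisenstein_sum \<Gamma> H \<eta> (as ! j) (\<sigma>s ! j) ((Bs' ! k ! m) (\<tau> j)) (w (rep C)) (hyp_act (rep C) \<omega>) s
        (\<Sum>l<length (Bs ! j). value_coeff (k, m) (j, l) * ip H (E (j, l) (hyp_act (rep C) \<omega>) s) (w (rep C)))"
      unfolding value_expansion[OF j(1), unfolded j(2), OF k(2)]
    proof (rule eisenstein_sum_linear_combination[OF \<Gamma>])
      fix l assume "l \<in> {..<length (Bs ! j)}"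
      then show "eisenstein_sum \<Gamma> H \<eta> (as ! j) (\<sigma>s ! j) (Bs ! j ! l) (w (rep C)) (hyp_act (rep C) \<omega>) s
          (ip H (E (j, l) (hyp_act (rep C) \<omega>) s) (w (rep C)))"
        using E[of j l] j(1) \<omega>C[OF C] wC s by (simp add: eisenstein_continuation_alt mem_ix)
    qed (use v wC in \<open>auto intro!: \<eta>_linear_combination\<close>)
  qed
  then show "eisenstein_sum \<Gamma>' H' induced_rep (as' ! k) (\<sigma>s' ! k) (Bs' ! k ! m) w \<omega> s
      (ip H' (induced_eisenstein E (k, m) \<omega> s) w)"
    unfolding ip_eq sum_value_coeff[OF km] .
qed

lemma restricted_eisenstein_continuation:
  assumes E: "\<And>k m. (k, m) \<in> set ix' \<Longrightarrow>
      eisenstein_continuation \<Gamma>' H' induced_rep (as' ! k) (\<sigma>s' ! k) (Bs' ! k ! m) (E (k, m))"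
    and jl: "(j, l) \<in> set ix"
  shows "eisenstein_continuation \<Gamma> H \<eta> (as ! j) (\<sigma>s ! j) (Bs ! j ! l) (restricted_eisenstein E (j, l))"
  unfolding eisenstein_continuation_alt
proof (intro ballI conjI allI impI)
  have E_vecs: "E p \<omega> s \<in> vecs H'" if "p \<in> set ix'" "\<omega> \<in> H3" for p \<omega> s
    using E[of "fst p" "snd p"] that by (auto simp: eisenstein_continuation_alt)
  fix \<omega> assume \<omega>: "\<omega> \<in> H3"
  show "restricted_eisenstein E (j, l) \<omega> s \<in> vecs H" for s
    unfolding restricted_eisenstein_def by (intro vecs_sum vecs_smul H'_vecsD(1)[OF E_vecs[OF _ \<omega>]])
  fix w assume w: "w \<in> vecs H"
  note pw = point_mass_vecs[OF w]
  have ip_eq: "ip H (restricted_eisenstein E (j, l) \<omega> s) w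
      = (\<Sum>p\<in>set ix'. lift_coeff (j, l) p * ip H' (E p \<omega> s) (point_mass w))" for s
    unfolding restricted_eisenstein_def
    by (subst ip_linear_combination)
      (auto simp: H'_vecsD(1)[OF E_vecs[OF _ \<omega>]] w ip_point_mass[OF E_vecs[OF _ \<omega>] w] intro!: sum.cong)
  show "(\<lambda>s. ip H (restricted_eisenstein E (j, l) \<omega> s) w) meromorphic_on UNIV"
    unfolding ip_eq
  proof (intro meromorphic_on_sum meromorphic_on_mult meromorphic_on_const)
    fix p assume "p \<in> set ix'"
    then show "(\<lambda>s. ip H' (E p \<omega> s) (point_mass w)) meromorphic_on UNIV"
      using E[of "fst p" "snd p"] \<omega> pw by (simp add: eisenstein_continuation_alt)
  qed
  fix s :: complex assume s: "2 < Re s"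
  have j: "j < length as" "l < length (Bs ! j)"
    using jl by (auto simp: mem_ix)
  have k: "\<kappa> j < length as'"
    by (rule \<kappa>[OF j(1)])
  have "eisenstein_sum \<Gamma>' H' induced_rep (as' ! \<kappa> j) (\<sigma>s' ! \<kappa> j) (lift j (Bs ! j ! l)) (point_mass w) \<omega> s
      (\<Sum>m<length (Bs' ! \<kappa> j). lift_coeff (j, l) (\<kappa> j, m) * ip H' (E (\<kappa> j, m) \<omega> s) (point_mass w))"
    unfolding lift_expansion[OF j]
  proof (rule H'.eisenstein_sum_linear_combination[OF \<Gamma>'])
    fix m assume "m \<in> {..<length (Bs' ! \<kappa> j)}"
    then show "eisenstein_sum \<Gamma>' H' induced_rep (as' ! \<kappa> j) (\<sigma>s' ! \<kappa> j) (Bs' ! \<kappa> j ! m) (point_mass w) \<omega> s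
        (ip H' (E (\<kappa> j, m) \<omega> s) (point_mass w))"
      using E[of "\<kappa> j" m] k \<omega> pw s by (simp add: eisenstein_continuation_alt mem_ix')
  next
    fix g m assume "g \<in> \<Gamma>'" "m \<in> {..<length (Bs' ! \<kappa> j)}"
    then show "induced_rep g (Bs' ! \<kappa> j ! m) \<in> vecs H'"
      using sing'D(1)[OF basis'_mem[OF k]] by (simp add: induced_rep_vecs)
  next
    fix g
    show "induced_rep g (\<Sum>m<length (Bs' ! \<kappa> j). smul H' (lift_coeff (j, l) (\<kappa> j, m)) (Bs' ! \<kappa> j ! m))
      = (\<Sum>m<length (Bs' ! \<kappa> j). smul H' (lift_coeff (j, l) (\<kappa> j, m)) (induced_rep g (Bs' ! \<kappa> j ! m)))"
      by (rule ext) (simp add: induced_rep_def sum_fun_apply H'_smul)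
  qed (simp_all add: pw)
  then show "eisenstein_sum \<Gamma> H \<eta> (as ! j) (\<sigma>s ! j) (Bs ! j ! l) w \<omega> s (ip H (restricted_eisenstein E (j, l) \<omega> s) w)"
    unfolding ip_eq sum_lift_coeff[OF jl] by (rule eisenstein_sum_restrict[OF j(1) basis_mem[OF j] w \<omega>])
qed

text \<open>The functional equation of the \<open>\<Gamma>\<close>-series at the finitely many points \<open>x \<omega>\<close>, with \<open>x\<close> running over the
  coset representatives, gives that of the \<open>\<Gamma>'\<close>-series at \<open>\<omega>\<close>, as a vector of the induced space is
  determined by its values at these \<open>x\<close>.\<close>

lemma scattering_matrix_induced:
  assumes S: "scattering_matrix \<Gamma> H \<eta> as \<sigma>s Bs S"
  shows "scattering_matrix \<Gamma>' H' induced_rep as' \<sigma>s' Bs' (\<lambda>s. A * S s * B)"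
proof -
  obtain E where Sc: "\<And>s. S s \<in> carrier_mat (length ix) (length ix)"
    and Sm: "\<And>i k. i < length ix \<Longrightarrow> k < length ix \<Longrightarrow> (\<lambda>s. S s $$ (i, k)) meromorphic_on UNIV"
    and E: "\<And>j l. (j, l) \<in> set ix \<Longrightarrow> eisenstein_continuation \<Gamma> H \<eta> (as ! j) (\<sigma>s ! j) (Bs ! j ! l) (E (j, l))"
    and fe: "\<And>i \<omega>. i < length ix \<Longrightarrow> \<omega> \<in> H3 \<Longrightarrow> \<forall>\<^sub>\<approx>s\<in>UNIV.
        E (ix ! i) \<omega> s = (\<Sum>k<length ix. smul H (S s $$ (i, k)) (E (ix ! k) \<omega> (2 - s)))"
    using S unfolding scattering_matrix_def Let_def by fast
  have E_vecs: "E q \<omega> s \<in> vecs H" if "q \<in> set ix" "\<omega> \<in> H3" for q \<omega> s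
    using E[of "fst q" "snd q"] that by (auto simp: eisenstein_continuation_alt)
  have "\<forall>\<^sub>\<approx>s\<in>UNIV. induced_eisenstein E (ix' ! i) \<omega> s =
      (\<Sum>m<length ix'. smul H' ((A * S s * B) $$ (i, m)) (induced_eisenstein E (ix' ! m) \<omega> (2 - s)))"
    if i: "i < length ix'" and \<omega>: "\<omega> \<in> H3" for i \<omega>
  proof -
    have "\<forall>\<^sub>\<approx>s\<in>UNIV. \<forall>C\<in>right_cosets \<Gamma> \<Gamma>'. \<forall>i\<in>{..<length ix}. E (ix ! i) (hyp_act (rep C) \<omega>) s =
        (\<Sum>k<length ix. smul H (S s $$ (i, k)) (E (ix ! k) (hyp_act (rep C) \<omega>) (2 - s)))"
      using finite_index rep_coset(1) \<Gamma>'_simps(4) \<omega>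
      by (intro eventually_ball_finite ballI fe) (auto intro: hyp_act_in_H3)
    then show ?thesis
    proof eventually_elim
      case (elim s)
      show ?case
      proof (rule H'_eqI)
        show "induced_eisenstein E (ix' ! i) \<omega> s \<in> vecs H'"
          using E_vecs \<omega> by (rule induced_eisenstein_rep(1))
        show "(\<Sum>m<length ix'. smul H' ((A * S s * B) $$ (i, m)) (induced_eisenstein E (ix' ! m) \<omega> (2 - s))) \<in> vecs H'"
          by (intro H'.vecs_sum H'.vecs_smul induced_eisenstein_rep(1)[OF E_vecs \<omega>])
        fix C assume C: "C \<in> right_cosets \<Gamma> \<Gamma>'"
        have val: "induced_eisenstein E (ix' ! m) \<omega> z (rep C)
            = (\<Sum>k<length ix. smul H (A $$ (m, k)) (E (ix ! k) (hyp_act (rep C) \<omega>) z))" if "m < length ix'" for m z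
        proof -
          have "induced_eisenstein E (ix' ! m) \<omega> z (rep C)
              = (\<Sum>q\<in>set ix. smul H (value_coeff (ix' ! m) q) (E q (hyp_act (rep C) \<omega>) z))"
            using E_vecs \<omega> C by (intro induced_eisenstein_rep(2)) auto
          then show ?thesis
            unfolding sum_eisenstein_index[symmetric] using that by (simp add: A_def)
        qed
        have "induced_eisenstein E (ix' ! i) \<omega> s (rep C)
            = (\<Sum>m<length ix'. smul H ((A * S s * B) $$ (i, m))
                (\<Sum>k<length ix. smul H (A $$ (m, k)) (E (ix ! k) (hyp_act (rep C) \<omega>) (2 - s))))"
          unfolding val[OF i]
          by (rule V.conjugate_relation[OF A_carrier B_carrier Sc B_A _ i]) (use elim C in auto)
        then show "induced_eisenstein E (ix' ! i) \<omega> s (rep C) =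
            (\<Sum>m<length ix'. smul H' ((A * S s * B) $$ (i, m)) (induced_eisenstein E (ix' ! m) \<omega> (2 - s))) (rep C)"
          by (simp add: sum_fun_apply H'_smul val)
      qed
    qed
  qed
  moreover have "A * S s * B \<in> carrier_mat (length ix') (length ix')" for s
    using Sc[of s] by (metis A_carrier B_carrier mult_carrier_mat)
  moreover have "(\<lambda>s. (A * S s * B) $$ (i, m)) meromorphic_on UNIV" if "i < length ix'" "m < length ix'" for i m
    using A_carrier B_carrier Sc Sm that by (rule meromorphic_conjugate_entry)
  ultimately show ?thesis
    using induced_eisenstein_continuation[of E, OF E] unfolding scattering_matrix_def Let_def
    by (intro conjI exI[of _ "induced_eisenstein E"]) auto
qed

text \<open>Here the functional equation of the \<open>\<Gamma>'\<close>-series is evaluated at one.\<close>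

lemma scattering_matrix_restricted:
  assumes S: "scattering_matrix \<Gamma>' H' induced_rep as' \<sigma>s' Bs' S"
  shows "scattering_matrix \<Gamma> H \<eta> as \<sigma>s Bs (\<lambda>s. B * S s * A)"
proof -
  obtain E where Sc: "\<And>s. S s \<in> carrier_mat (length ix') (length ix')"
    and Sm: "\<And>i k. i < length ix' \<Longrightarrow> k < length ix' \<Longrightarrow> (\<lambda>s. S s $$ (i, k)) meromorphic_on UNIV"
    and E: "\<And>k m. (k, m) \<in> set ix' \<Longrightarrow> eisenstein_continuation \<Gamma>' H' induced_rep (as' ! k) (\<sigma>s' ! k) (Bs' ! k ! m) (E (k, m))"
    and fe: "\<And>i \<omega>. i < length ix' \<Longrightarrow> \<omega> \<in> H3 \<Longrightarrow> \<forall>\<^sub>\<approx>s\<in>UNIV.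
        E (ix' ! i) \<omega> s = (\<Sum>k<length ix'. smul H' (S s $$ (i, k)) (E (ix' ! k) \<omega> (2 - s)))"
    using S unfolding scattering_matrix_def Let_def by fast
  have "\<forall>\<^sub>\<approx>s\<in>UNIV. restricted_eisenstein E (ix ! i) \<omega> s =
      (\<Sum>m<length ix. smul H ((B * S s * A) $$ (i, m)) (restricted_eisenstein E (ix ! m) \<omega> (2 - s)))"
    if i: "i < length ix" and \<omega>: "\<omega> \<in> H3" for i \<omega>
  proof -
    have "\<forall>\<^sub>\<approx>s\<in>UNIV. \<forall>i\<in>{..<length ix'}. E (ix' ! i) \<omega> s =
        (\<Sum>k<length ix'. smul H' (S s $$ (i, k)) (E (ix' ! k) \<omega> (2 - s)))"
      using \<omega> by (intro eventually_ball_finite ballI fe) auto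
    then show ?thesis
    proof eventually_elim
      case (elim s)
      have val: "restricted_eisenstein E (ix ! m) \<omega> z
          = (\<Sum>k<length ix'. smul H (B $$ (m, k)) (E (ix' ! k) \<omega> z I2))" if "m < length ix" for m z
        unfolding restricted_eisenstein_def sum_eisenstein_index[symmetric] using that by (simp add: B_def)
      have "restricted_eisenstein E (ix ! i) \<omega> s = (\<Sum>m<length ix. smul H ((B * S s * A) $$ (i, m))
          (\<Sum>k<length ix'. smul H (B $$ (m, k)) (E (ix' ! k) \<omega> (2 - s) I2)))"
        unfolding val[OF i]
        by (rule V.conjugate_relation[OF B_carrier A_carrier Sc A_B _ i])
          (use elim in \<open>simp add: sum_fun_apply H'_smul\<close>)
      then show ?case
        by (simp add: val)
    qed
  qed
  moreover have "B * S s * A \<in> carrier_mat (length ix) (length ix)" for s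
    using Sc[of s] by (metis A_carrier B_carrier mult_carrier_mat)
  moreover have "(\<lambda>s. (B * S s * A) $$ (i, m)) meromorphic_on UNIV" if "i < length ix" "m < length ix" for i m
    using B_carrier A_carrier Sc Sm that by (rule meromorphic_conjugate_entry)
  ultimately show ?thesis
    using restricted_eisenstein_continuation[of E, OF E] unfolding scattering_matrix_def Let_def
    by (intro conjI exI[of _ "restricted_eisenstein E"]) auto
qed

text \<open>Both scattering functions are definite descriptions, so it suffices that the same functions satisfy
  the two descriptions.\<close>

lemma scattering_function_induced:
  "scattering_function \<Gamma> H \<eta> as \<sigma>s Bs = scattering_function \<Gamma>' H' induced_rep as' \<sigma>s' Bs'"
proof -
  have carrier: "S s \<in> carrier_mat (length ix) (length ix)" if "scattering_matrix \<Gamma> H \<eta> as \<sigma>s Bs S" for S s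
    using that by (simp add: scattering_matrix_def Let_def)
  have carrier': "S s \<in> carrier_mat (length ix') (length ix')"
    if "scattering_matrix \<Gamma>' H' induced_rep as' \<sigma>s' Bs' S" for S s
    using that by (simp add: scattering_matrix_def Let_def)
  have "(\<exists>S. scattering_matrix \<Gamma> H \<eta> as \<sigma>s Bs S \<and> \<phi> = remove_sings (\<lambda>s. Determinant.det (S s))) \<longleftrightarrow>
        (\<exists>S. scattering_matrix \<Gamma>' H' induced_rep as' \<sigma>s' Bs' S \<and> \<phi> = remove_sings (\<lambda>s. Determinant.det (S s)))"
    (is "?L \<longleftrightarrow> ?R") for \<phi>
  proof
    assume ?L
    then obtain S where S: "scattering_matrix \<Gamma> H \<eta> as \<sigma>s Bs S"
      and \<phi>: "\<phi> = remove_sings (\<lambda>s. Determinant.det (S s))"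
      by blast
    have "Determinant.det (A * S s * B) = Determinant.det (S s)" for s
      by (rule det_conjugate[OF A_carrier B_carrier carrier[OF S] A_B B_A])
    then show ?R
      using scattering_matrix_induced[OF S] \<phi> by (intro exI[of _ "\<lambda>s. A * S s * B"]) simp
  next
    assume ?R
    then obtain S where S: "scattering_matrix \<Gamma>' H' induced_rep as' \<sigma>s' Bs' S"
      and \<phi>: "\<phi> = remove_sings (\<lambda>s. Determinant.det (S s))"
      by blast
    have "Determinant.det (B * S s * A) = Determinant.det (S s)" for s
      by (rule det_conjugate[OF B_carrier A_carrier carrier'[OF S] B_A A_B])
    then show ?L
      using scattering_matrix_restricted[OF S] \<phi> by (intro exI[of _ "\<lambda>s. B * S s * A"]) simp
  qed
  then show ?thesis
    by (simp add: scattering_function_def)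
qed

end

theorem theorem2:
  fixes \<Gamma> \<Gamma>' :: "cmat2 set"
    and H :: "'v::ab_group_add hermitian"
    and \<eta> :: "cmat2 \<Rightarrow> 'v \<Rightarrow> 'v"
    and as as' :: "complex option list"
    and \<sigma>s \<sigma>s' :: "cmat2 list"
    and Bs :: "'v list list"
    and Bs' :: "(cmat2 \<Rightarrow> 'v) list list"
  assumes "subgroup \<Gamma> SL2C" and "subgroup \<Gamma>' SL2C" and "\<Gamma> \<subseteq> \<Gamma>'"
    and "discrete \<Gamma>" and "discrete \<Gamma>'"
    and "{Finite_Cartesian_Product.mat 1, - Finite_Cartesian_Product.mat 1} \<subseteq> \<Gamma>"
    and "{Finite_Cartesian_Product.mat 1, - Finite_Cartesian_Product.mat 1} \<subseteq> \<Gamma>'"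
    and "finite_covolume \<Gamma>"
    and "finite (right_cosets \<Gamma> \<Gamma>')"
    and "hermitian_space H" and "unitary_rep \<Gamma> H \<eta>"
    and "complete_cusps \<Gamma> as" and "scaling_matrices as \<sigma>s"
    and "complete_cusps \<Gamma>' as'" and "scaling_matrices as' \<sigma>s'"
    and "compatible_scaling \<Gamma>' as' \<sigma>s' as \<sigma>s"
    and "singular_bases \<Gamma> H \<eta> as Bs"
    and "singular_bases \<Gamma>' (induced_space \<Gamma>' \<Gamma> H \<eta>) induced_rep as' Bs'"
  shows "scattering_function \<Gamma> H \<eta> as \<sigma>s Bs =
         scattering_function \<Gamma>' (induced_space \<Gamma>' \<Gamma> H \<eta>) induced_rep as' \<sigma>s' Bs'"
proof -
  have "\<forall>j. \<exists>k. \<exists>\<tau>. j < length as \<longrightarrow> k < length as' \<and> \<tau> \<in> \<Gamma>' \<and>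
      moebius \<tau> (as' ! k) = as ! j \<and> \<sigma>s ! j = \<tau> ** (\<sigma>s' ! k)"
    using assms(16) unfolding compatible_scaling_def by blast
  then obtain \<kappa> \<tau> where \<kappa>\<tau>: "\<forall>j. j < length as \<longrightarrow> \<kappa> j < length as' \<and> \<tau> j \<in> \<Gamma>' \<and>
      moebius (\<tau> j) (as' ! \<kappa> j) = as ! j \<and> \<sigma>s ! j = \<tau> j ** (\<sigma>s' ! \<kappa> j)"
    by metis
  interpret induction_bases H \<Gamma> \<Gamma>' \<eta> as as' \<sigma>s \<sigma>s' \<kappa> \<tau> Bs Bs'
  proof (intro induction_bases.intro induction_setting.intro induction_setting_axioms.intro
        induction_bases_axioms.intro ip_space_hermitian assms)
    show "ip H w u = cnj (ip H u w)" if "u \<in> vecs H" "w \<in> vecs H" for u w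
      using assms(10) that unfolding hermitian_space_def by blast
  qed (use \<kappa>\<tau> in blast)+
  show ?thesis
    by (rule scattering_function_induced)
qed

end
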